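(* Let $n\ge1$ and let $f(x)=(f_1(x_1),\dots,f_n(x_n))$ for $x=(x_1,\dots,x_n)\in\mathbf R^{2n}$, $x_k\in\mathbf R^2$, where each $f_k\in C^1(\mathbf R^2,\mathbf R^2)$ is such that for the planar system $\dot x_k=f_k(x_k)$ the origin is the unique equilibrium point and all other trajectories are closed curves surrounding the origin. Let $g\in C^{0,1}_{t,x}(\mathbf R\times\mathbf R^{2n},\mathbf R^{2n})$. Let $x(t)$ be a bounded solution of $\dot x=f(x)+g(t,x)$, defined on some half-line $[t_0,+\infty)$, and suppose that for some real $p>1$ $$t^p\|g(t,x(t))\|\to0\quad\text{as } t\to+\infty.$$ Then $x(t)$ approaches a certain invariant torus of the unperturbed system $\dot x=f(x)$; that is, there is an invariant torus $\mathcal T\subset\mathbf R^{2n}$ of $\dot x=f(x)$ such that $\operatorname{dist}(x(t),\mathcal T)\to0$ as $t\to+\infty$.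
   Context: $C^{0,1}_{t,x}$ denotes functions continuous in $(t,x)$ and continuously differentiable with respect to $x$. $\|\cdot\|$ is the Euclidean norm. An invariant torus of the unperturbed system $\dot x=f(x)$ is a product $\mathcal T=C_1\times\dots\times C_n$, where each $C_k\subset\mathbf R^2$ is a trajectory of $\dot x_k=f_k(x_k)$, i.e. either a closed trajectory surrounding the origin or (degenerate case) the equilibrium point $\{0\}$. *)

theory Defs
  imports "HOL-Analysis.Analysis"
begin

definition C1_map :: "('a::euclidean_space \<Rightarrow> 'b::euclidean_space) \<Rightarrow> bool" where
  "C1_map F \<longleftrightarrow>
     (\<exists>F' :: 'a \<Rightarrow> 'a \<Rightarrow>\<^sub>L 'b.
        (\<forall>x. (F has_derivative blinfun_apply (F' x)) (at x)) \<and> continuous_on UNIV F')"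

text \<open>Joint continuity is required of \<open>g\<close> only; the \<open>x\<close>-derivative need not be continuous in
  \<open>t\<close>. Functions whose \<open>x\<close>-derivative is continuous in \<open>(t, x)\<close> are included.\<close>

definition C01_map :: "(real \<Rightarrow> 'a::euclidean_space \<Rightarrow> 'b::euclidean_space) \<Rightarrow> bool" where
  "C01_map g \<longleftrightarrow> continuous_on UNIV (\<lambda>(t, x). g t x) \<and> (\<forall>t. C1_map (g t))"

definition autonomous_solution ::
    "('a::euclidean_space \<Rightarrow> 'a) \<Rightarrow> (real \<Rightarrow> 'a) \<Rightarrow> real set \<Rightarrow> bool" where
  "autonomous_solution F \<phi> I \<longleftrightarrow>
     open I \<and> is_interval I \<and> I \<noteq> {} \<and>
     (\<forall>t\<in>I. (\<phi> has_vector_derivative F (\<phi> t)) (at t))"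

definition maximal_solution ::
    "('a::euclidean_space \<Rightarrow> 'a) \<Rightarrow> (real \<Rightarrow> 'a) \<Rightarrow> real set \<Rightarrow> bool" where
  "maximal_solution F \<phi> I \<longleftrightarrow>
     autonomous_solution F \<phi> I \<and>
     (\<forall>\<psi> J. autonomous_solution F \<psi> J \<and> I \<subseteq> J \<and> (\<forall>t\<in>I. \<psi> t = \<phi> t) \<longrightarrow> J = I)"

definition trajectory :: "('a::euclidean_space \<Rightarrow> 'a) \<Rightarrow> 'a set \<Rightarrow> bool" where
  "trajectory F C \<longleftrightarrow> (\<exists>\<phi> I. maximal_solution F \<phi> I \<and> C = \<phi> ` I)"

definition closed_trajectory :: "('a::euclidean_space \<Rightarrow> 'a) \<Rightarrow> 'a set \<Rightarrow> bool" where
  "closed_trajectory F C \<longleftrightarrow>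
     (\<exists>\<phi> T. autonomous_solution F \<phi> UNIV \<and> T > 0 \<and> (\<forall>t. \<phi> (t + T) = \<phi> t) \<and>
            \<not> \<phi> constant_on UNIV \<and> C = range \<phi>)"

text \<open>A closed curve \<open>C\<close> surrounds the origin if the origin lies in a bounded component
  of the complement of \<open>C\<close>, i.e. in \<^term>\<open>inside C\<close>.\<close>

definition global_center :: "(real ^ 2 \<Rightarrow> real ^ 2) \<Rightarrow> bool" where
  "global_center F \<longleftrightarrow>
     (\<forall>y. F y = 0 \<longleftrightarrow> y = 0) \<and>
     (\<forall>C. trajectory F C \<and> C \<noteq> {0} \<longrightarrow> closed_trajectory F C \<and> 0 \<in> inside C)"

text \<open>The space \<open>\<real>\<^sup>2\<^sup>n\<close> is rendered as \<^typ>\<open>(real ^ 2) ^ 'n\<close>, with \<open>n = CARD('n)\<close>; its norm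
  is the Euclidean norm of all \<open>2n\<close> coordinates.\<close>

definition product_field ::
    "('n::finite \<Rightarrow> real ^ 2 \<Rightarrow> real ^ 2) \<Rightarrow> (real ^ 2) ^ 'n \<Rightarrow> (real ^ 2) ^ 'n" where
  "product_field f x = (\<chi> k. f k (x $ k))"

definition invariant_torus ::
    "('n::finite \<Rightarrow> real ^ 2 \<Rightarrow> real ^ 2) \<Rightarrow> ((real ^ 2) ^ 'n) set \<Rightarrow> bool" where
  "invariant_torus f S \<longleftrightarrow>
     (\<exists>C. (\<forall>k. trajectory (f k) (C k) \<and>
               (closed_trajectory (f k) (C k) \<and> 0 \<in> inside (C k) \<or> C k = {0})) \<and>
          S = {x. \<forall>k. x $ k \<in> C k})"

end

theory Submission imports Defs begin

text \<open>The equations decouple once \<open>g(t, x(t))\<close> is read as a given forcing \<open>h(t)\<close> with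
  \<open>\<integral>\<bar>h\<bar> < \<infinity>\<close>, so it suffices to treat one planar system \<open>y' = F(y) + h(t)\<close>. Either
  \<open>y \<rightarrow> 0\<close>, or \<open>y\<close> accumulates at some \<open>a \<noteq> 0\<close>; let \<open>\<Gamma>\<close> be the closed orbit of \<open>a\<close>.
  Let \<open>V(z)\<close> be the largest distance from \<open>\<Gamma>\<close> attained on the orbit of \<open>z\<close>. It is a first integral
  of \<open>F\<close>, and by Gronwall's inequality it is Lipschitz near \<open>\<Gamma>\<close>, provided that the periods of the
  orbits near \<open>\<Gamma>\<close> are bounded. Hence \<open>V(y(t))\<close> increases by at most a constant times
  \<open>\<integral>\<bar>h\<bar>\<close> from a time at which it is small, which forces \<open>y\<close> to approach \<open>\<Gamma>\<close>.

  The bound on the periods comes from a transversal through \<open>a\<close>: the return map is continuous and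
  injective and fixes \<open>a\<close>, so its square is increasing; as every orbit is compact, the point
  of a nearby orbit that is closest to \<open>a\<close> on one side of the transversal is fixed by the square.\<close>

section \<open>Solutions of locally Lipschitz systems\<close>

text \<open>Balls about the origin replace the usual neighbourhoods, so that every bounded set gets
  a single Lipschitz constant. Gronwall's inequality can then be applied along whole arcs and orbits
  at once.\<close>

definition bounded_lipschitz :: "('a::euclidean_space \<Rightarrow> 'b::euclidean_space) \<Rightarrow> bool" where
  "bounded_lipschitz F \<longleftrightarrow> (\<forall>R. \<exists>L. L-lipschitz_on (cball 0 R) F)"

lemma bounded_lipschitzE:
  assumes "bounded_lipschitz F" "bounded X"
  obtains L where "L-lipschitz_on X F"
proof -
  obtain R where "X \<subseteq> cball 0 R"
    using assms(2) by (metis bounded_iff mem_cball_0 subsetI)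
  moreover obtain L where "L-lipschitz_on (cball 0 R) F"
    using assms(1) by (auto simp: bounded_lipschitz_def)
  ultimately show thesis
    using that lipschitz_on_subset by blast
qed

lemma bounded_lipschitz_minus:
  assumes "bounded_lipschitz F"
  shows "bounded_lipschitz (\<lambda>x. - F x)"
  using assms lipschitz_on_minus unfolding bounded_lipschitz_def by blast

lemma bounded_lipschitz_continuous:
  assumes "bounded_lipschitz F"
  shows "continuous_on S F"
proof -
  have "isCont F z" for z
  proof -
    obtain L where L: "L-lipschitz_on (ball z 1) F"
      using bounded_lipschitzE[OF assms bounded_ball] by blast
    have "continuous_on (ball z 1) F"
      by (rule lipschitz_on_continuous_on[OF L])
    then show ?thesis
      by (simp add: continuous_on_eq_continuous_at)
  qed
  then show ?thesis
    by (simp add: continuous_at_imp_continuous_on)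
qed

text \<open>The continuous derivative is bounded on the compact ball, and the ball is convex, so the
  mean value inequality applies.\<close>

lemma C1_map_bounded_lipschitz:
  assumes "C1_map F"
  shows "bounded_lipschitz F"
  unfolding bounded_lipschitz_def
proof
  fix R :: real
  obtain F' :: "'a \<Rightarrow> 'a \<Rightarrow>\<^sub>L 'b" where F':
    "\<And>x. (F has_derivative blinfun_apply (F' x)) (at x)" "continuous_on UNIV F'"
    using assms by (auto simp: C1_map_def)
  have "compact (F' ` cball 0 R)"
    using F'(2) by (intro compact_continuous_image) (auto intro: continuous_on_subset)
  then obtain B where B: "B > 0" "\<And>x. x \<in> cball 0 R \<Longrightarrow> norm (F' x) \<le> B"
    using compact_imp_bounded bounded_pos by (metis imageI)
  have "B-lipschitz_on (cball 0 R) F"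
  proof (rule lipschitz_onI)
    fix x y :: 'a assume "x \<in> cball 0 R" "y \<in> cball 0 R"
    then show "dist (F x) (F y) \<le> B * dist x y"
      unfolding dist_norm
      by (intro differentiable_bound[of "cball 0 R" F "\<lambda>x. blinfun_apply (F' x)"])
        (auto intro: has_derivative_at_withinI F'(1) B(2) simp flip: norm_blinfun.rep_eq)
  qed (use B in simp)
  then show "\<exists>L. L-lipschitz_on (cball 0 R) F" by blast
qed

section \<open>Gronwall's inequality, comparison of solutions, uniqueness\<close>

lemma gronwall:
  fixes u :: "real \<Rightarrow> real"
  assumes u: "continuous_on {a..b} u" and L: "0 \<le> L"
    and le: "\<And>t. t \<in> {a..b} \<Longrightarrow> u t \<le> A + L * integral {a..t} u"
    and t: "t \<in> {a..b}"
  shows "u t \<le> A * exp (L * (t - a))"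
proof -
  \<comment> \<open>The bound on \<open>u\<close> times an integrating factor. By \<open>le\<close>
    its derivative is nonpositive, and its value at \<open>a\<close> is \<open>A\<close>.\<close>
  define W where "W r = (A + L * integral {a..r} u) * exp (- L * (r - a))" for r
  have U: "((\<lambda>r. integral {a..r} u) has_real_derivative u r) (at r within {a..b})"
    if "r \<in> {a..b}" for r
    using integral_has_vector_derivative[OF u that]
    by (simp add: has_real_derivative_iff_has_vector_derivative)
  have W': "(W has_real_derivative L * exp (- L * (r - a)) * (u r - (A + L * integral {a..r} u)))
      (at r within {a..b})" if "r \<in> {a..b}" for r
  proof -
    have 1: "((\<lambda>r. A + L * integral {a..r} u) has_real_derivative L * u r) (at r within {a..b})"
      using DERIV_add[OF DERIV_const DERIV_cmult[OF U[OF that]]] by simp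
    have 2: "((\<lambda>r. exp (- L * (r - a))) has_real_derivative exp (- L * (r - a)) * (- L)) (at r within {a..b})"
      by (auto intro!: derivative_eq_intros)
    show ?thesis
      unfolding W_def by (rule DERIV_cong[OF DERIV_mult[OF 1 2]]) (simp add: algebra_simps)
  qed
  have "W t \<le> W a"
  proof (rule DERIV_nonpos_imp_decreasing_open[of a t W])
    show "continuous_on {a..t} W"
      using t by (intro continuous_on_subset[OF DERIV_continuous_on[OF W']]) auto
    fix r assume r: "a < r" "r < t"
    then have "at r within {a..b} = at r"
      using t by (intro at_within_interior) auto
    moreover have "L * exp (- L * (r - a)) * (u r - (A + L * integral {a..r} u)) \<le> 0"
      using L le[of r] r t by (intro mult_nonneg_nonpos) auto
    ultimately show "\<exists>y. DERIV W r :> y \<and> y \<le> 0"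
      using W'[of r] r t by force
  qed (use t in auto)
  then have "(A + L * integral {a..t} u) * exp (- L * (t - a)) \<le> A"
    by (simp add: W_def)
  then have "(A + L * integral {a..t} u) * exp (- L * (t - a)) * exp (L * (t - a)) \<le> A * exp (L * (t - a))"
    by (rule mult_right_mono) simp
  then have "A + L * integral {a..t} u \<le> A * exp (L * (t - a))"
    by (simp add: mult.assoc flip: exp_add)
  with le[OF t] show ?thesis by simp
qed

text \<open>Subtract the two integral equations. The forcing is estimated by its integral over all
  of \<open>{s..t}\<close>; being independent of the current time, it joins the initial distance as
  the constant \<open>A\<close> of \<open>gronwall\<close>. With \<open>h = 0\<close> this is
  dependence on the initial value, hence uniqueness.\<close>

lemma perturbed_solution_dist_le:
  fixes F :: "'a::euclidean_space \<Rightarrow> 'a" and s t :: real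
  assumes F: "L-lipschitz_on X F"
    and z1: "\<And>r. r \<in> {s..t} \<Longrightarrow> (z1 has_vector_derivative F (z1 r) + h r) (at r within {s..t})"
    and z2: "\<And>r. r \<in> {s..t} \<Longrightarrow> (z2 has_vector_derivative F (z2 r)) (at r within {s..t})"
    and X: "\<And>r. r \<in> {s..t} \<Longrightarrow> z1 r \<in> X" "\<And>r. r \<in> {s..t} \<Longrightarrow> z2 r \<in> X"
    and h: "continuous_on {s..t} h" and st: "s \<le> t"
  shows "norm (z1 t - z2 t) \<le> (norm (z1 s - z2 s) + integral {s..t} (\<lambda>r. norm (h r))) * exp (L * (t - s))"
proof -
  have L: "0 \<le> L" using F lipschitz_on_nonneg by blast
  have c1: "continuous_on {s..t} z1" and c2: "continuous_on {s..t} z2"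
    by (rule continuous_on_vector_derivative, erule z1, rule continuous_on_vector_derivative, erule z2)
  have cF: "continuous_on X F" by (rule lipschitz_on_continuous_on[OF F])
  have cF1: "continuous_on {s..t} (\<lambda>r. F (z1 r))" and cF2: "continuous_on {s..t} (\<lambda>r. F (z2 r))"
    using X by (auto intro!: continuous_on_compose2[OF cF] c1 c2)
  define w where "w r = norm (z1 r - z2 r)" for r
  have cw: "continuous_on {s..t} w"
    unfolding w_def by (intro continuous_intros c1 c2)
  have "w r \<le> (w s + integral {s..t} (\<lambda>r. norm (h r))) + L * integral {s..r} w"
    if r: "r \<in> {s..t}" for r
  proof -
    have sub: "{s..r} \<subseteq> {s..t}" using r by auto
    have c: "continuous_on {s..r} g" if "continuous_on {s..t} g" for g :: "real \<Rightarrow> 'c::topological_space"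
      using that sub continuous_on_subset by blast
    have "((\<lambda>q. F (z1 q) + h q - F (z2 q)) has_integral (z1 r - z2 r) - (z1 s - z2 s)) {s..r}"
    proof (rule fundamental_theorem_of_calculus)
      fix q assume "q \<in> {s..r}"
      then have "q \<in> {s..t}" using sub by blast
      from has_vector_derivative_diff[OF z1[OF this] z2[OF this]]
      show "((\<lambda>q. z1 q - z2 q) has_vector_derivative F (z1 q) + h q - F (z2 q)) (at q within {s..r})"
        using sub by (rule has_vector_derivative_within_subset)
    qed (use r in auto)
    then have eq: "z1 r - z2 r = (z1 s - z2 s) + integral {s..r} (\<lambda>q. F (z1 q) + h q - F (z2 q))"
      by (simp add: integral_unique)
    have "norm (integral {s..r} (\<lambda>q. F (z1 q) + h q - F (z2 q))) \<le> integral {s..r} (\<lambda>q. L * w q + norm (h q))"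
    proof (rule integral_norm_bound_integral)
      fix q assume "q \<in> {s..r}"
      then have q: "q \<in> {s..t}" using sub by blast
      have "norm (F (z1 q) - F (z2 q)) \<le> L * w q"
        using lipschitz_on_normD[OF F X(1)[OF q] X(2)[OF q]] by (simp add: w_def)
      moreover have "F (z1 q) + h q - F (z2 q) = (F (z1 q) - F (z2 q)) + h q" by simp
      ultimately show "norm (F (z1 q) + h q - F (z2 q)) \<le> L * w q + norm (h q)"
        by (metis add_mono norm_triangle_ineq order_refl order_trans)
    qed (intro integrable_continuous_real c continuous_intros cF1 cF2 h cw)+
    also have "\<dots> = L * integral {s..r} w + integral {s..r} (\<lambda>q. norm (h q))"
      by (subst integral_add)
        (auto intro!: integrable_continuous_real c continuous_intros h cw)
    also have "integral {s..r} (\<lambda>q. norm (h q)) \<le> integral {s..t} (\<lambda>q. norm (h q))"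
      by (rule integral_subset_le[OF sub])
        (intro integrable_continuous_real c continuous_intros h | simp)+
    finally show ?thesis
      unfolding w_def using eq norm_triangle_ineq[of "z1 s - z2 s" "integral {s..r} (\<lambda>q. F (z1 q) + h q - F (z2 q))"]
      by (simp add: w_def)
  qed
  from gronwall[OF cw L this, of t] show ?thesis
    using st by (simp add: w_def)
qed

lemma solution_unique_right:
  fixes F :: "'a::euclidean_space \<Rightarrow> 'a" and s t :: real
  assumes F: "bounded_lipschitz F"
    and z1: "\<And>r. r \<in> {s..t} \<Longrightarrow> (z1 has_vector_derivative F (z1 r)) (at r within {s..t})"
    and z2: "\<And>r. r \<in> {s..t} \<Longrightarrow> (z2 has_vector_derivative F (z2 r)) (at r within {s..t})"
    and eq: "z1 s = z2 s" and st: "s \<le> t"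
  shows "z1 t = z2 t"
proof -
  have "continuous_on {s..t} z1" "continuous_on {s..t} z2"
    by (rule continuous_on_vector_derivative, erule z1, rule continuous_on_vector_derivative, erule z2)
  then have "bounded (z1 ` {s..t} \<union> z2 ` {s..t})"
    by (simp add: compact_continuous_image compact_imp_bounded)
  then obtain L where "L-lipschitz_on (z1 ` {s..t} \<union> z2 ` {s..t}) F"
    using bounded_lipschitzE[OF F] by blast
  then have "norm (z1 t - z2 t)
      \<le> (norm (z1 s - z2 s) + integral {s..t} (\<lambda>r. norm (0::'a))) * exp (L * (t - s))"
    by (rule perturbed_solution_dist_le) (use z1 z2 st in auto)
  then show ?thesis
    using eq by simp
qed

lemma has_vector_derivative_reflect:
  assumes "(z has_vector_derivative v) (at (- r))"
  shows "((\<lambda>r. z (- r)) has_vector_derivative - v) (at r)"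
proof -
  have "((\<lambda>r::real. - r) has_vector_derivative -1) (at r)"
    by (auto intro!: derivative_eq_intros)
  from vector_diff_chain_at[OF this, of z v] assms show ?thesis
    by (simp add: o_def)
qed

text \<open>Times after \<open>s\<close> are covered by the forward result; times before
  \<open>s\<close> reduce to it by reversing time, which replaces \<open>F\<close> by
  \<open>- F\<close>.\<close>

lemma autonomous_solution_unique:
  assumes F: "bounded_lipschitz F"
    and 1: "autonomous_solution F z1 I" and 2: "autonomous_solution F z2 I"
    and s: "s \<in> I" "z1 s = z2 s" and t: "t \<in> I"
  shows "z1 t = z2 t"
proof (cases "s \<le> t")
  case True
  have I: "is_interval I"
    using 1 by (simp add: autonomous_solution_def)
  have sub: "r \<in> {s..t} \<Longrightarrow> r \<in> I" for r
    using mem_is_interval_1_I[OF I s(1) t, of r] by simp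
  have der: "(z has_vector_derivative F (z r)) (at r within {s..t})"
    if "autonomous_solution F z I" "r \<in> {s..t}" for z r
  proof (rule has_vector_derivative_at_within)
    show "(z has_vector_derivative F (z r)) (at r)"
      using that(1) sub[OF that(2)] by (simp add: autonomous_solution_def)
  qed
  show ?thesis
    by (rule solution_unique_right[OF F der[OF 1] der[OF 2] s(2) True])
next
  case False
  have "is_interval I"
    using 1 by (simp add: autonomous_solution_def)
  then have sub: "- r \<in> I" if "r \<in> {-s..-t}" for r
    using mem_is_interval_1_I[OF _ t s(1), of "- r"] that by simp
  have refl: "((\<lambda>r. z (- r)) has_vector_derivative - F (z (- r))) (at r within {-s..-t})"
    if "autonomous_solution F z I" "r \<in> {-s..-t}" for z r
  proof (rule has_vector_derivative_at_within, rule has_vector_derivative_reflect)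
    show "(z has_vector_derivative F (z (- r))) (at (- r))"
      using that(1) sub[OF that(2)] by (simp add: autonomous_solution_def)
  qed
  have "z1 (- (- t)) = z2 (- (- t))"
    by (rule solution_unique_right[OF bounded_lipschitz_minus[OF F] refl[OF 1] refl[OF 2]])
      (use s False in auto)
  then show ?thesis by simp
qed

section \<open>Existence of solutions\<close>

text \<open>Picard's integral operator is a contraction. It acts on bounded continuous functions on
  the whole line, with values in the unit ball about \<open>b\<close>; clamping the upper limit of
  integration to \<open>{-e..e}\<close> makes this space usable although only short times
  matter.\<close>

lemma local_solution_exists:
  fixes F :: "'a::euclidean_space \<Rightarrow> 'a"
  assumes F: "bounded_lipschitz F"
  obtains e z where "e > 0" "z 0 = b" "autonomous_solution F z {-e<..<e}"
proof -
  define B where "B = cball b 1"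
  obtain L where L: "L-lipschitz_on B F"
    using bounded_lipschitzE[OF F bounded_cball] B_def by metis
  have L0: "0 \<le> L" using L lipschitz_on_nonneg by blast
  have cF: "continuous_on X F" for X
    by (rule bounded_lipschitz_continuous[OF F])
  have "compact (F ` B)"
    unfolding B_def by (intro compact_continuous_image cF compact_cball)
  then obtain M where M: "M > 0" "\<And>x. x \<in> B \<Longrightarrow> norm (F x) \<le> M"
    using compact_imp_bounded bounded_pos by (metis imageI)
  \<comment> \<open>The operator involves an integral of length at most \<open>2 * e\<close> and one
    of length \<open>e\<close>. Hence \<open>3 * e * M \<le> 1\<close> keeps the values in
    \<open>B\<close>, and \<open>3 * e * L < 1\<close> makes it a contraction.\<close>
  define e where "e = 1 / (4 * (M + L + 1))"
  have e: "e > 0" "3 * e * M \<le> 1" "3 * e * L < 1"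
    using M L0 by (auto simp: e_def field_simps)
  define cl where "cl t = max (-e) (min e t)" for t :: real
  have cl: "cl t \<in> {-e..e}" "t \<in> {-e..e} \<Longrightarrow> cl t = t" for t
    using e by (auto simp: cl_def)
  \<comment> \<open>The difference of two integrals starting at \<open>-e\<close> stands for the
    oriented integral from 0 to \<open>cl t\<close>; the integral over \<open>{0..t}\<close> itself
    would be 0 for negative \<open>t\<close>.\<close>
  define T0 where "T0 u t = b + integral {-e..cl t} (\<lambda>r. F (u r)) - integral {-e..0} (\<lambda>r. F (u r))"
    for u :: "real \<Rightarrow> 'a" and t
  define S :: "(real \<Rightarrow>\<^sub>C 'a) set" where "S = PiC UNIV (\<lambda>_. B)"
  have S: "u \<in> S \<longleftrightarrow> (\<forall>t. apply_bcontfun u t \<in> B)" for u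
    by (auto simp: S_def mem_PiC_iff)
  have cFu: "continuous_on X (\<lambda>r. F (apply_bcontfun u r))" for X u
    by (intro continuous_on_compose2[OF cF[of UNIV]]) auto
  have int_le: "norm (integral {-e..c} f) \<le> K * (2 * e)"
    if "c \<in> {-e..e}" "continuous_on UNIV f" "\<And>r. norm (f r) \<le> K" for c K and f :: "real \<Rightarrow> 'a"
  proof -
    have "K \<ge> 0" using that(3)[of 0] norm_ge_zero order_trans by blast
    have "norm (integral {-e..c} f) \<le> K * (c - (-e))"
      using that by (intro integral_bound) (auto intro: continuous_on_subset)
    also have "\<dots> \<le> K * (2 * e)"
      using that \<open>K \<ge> 0\<close> by (intro mult_left_mono) auto
    finally show ?thesis .
  qed
  have int_le0: "norm (integral {-e..0} f) \<le> K * e"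
    if "continuous_on UNIV f" "\<And>r. norm (f r) \<le> K" for K and f :: "real \<Rightarrow> 'a"
  proof -
    have "norm (integral {-e..0} f) \<le> K * (0 - (-e))"
      using that e by (intro integral_bound) (auto intro: continuous_on_subset)
    then show ?thesis by simp
  qed
  have T0_b: "norm (T0 u t - b) \<le> 1" if "u \<in> S" for u t
  proof -
    have le: "norm (F (apply_bcontfun u r)) \<le> M" for r
      using that M(2) by (simp add: S)
    have "norm (T0 u t - b) \<le> norm (integral {-e..cl t} (\<lambda>r. F (u r))) + norm (integral {-e..0} (\<lambda>r. F (u r)))"
      by (simp add: T0_def norm_triangle_ineq4)
    also have "\<dots> \<le> M * (2 * e) + M * e"
      by (intro add_mono int_le int_le0 cl cFu le)
    also have "\<dots> \<le> 1" using e by (simp add: algebra_simps)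
    finally show ?thesis .
  qed
  have T0_cont: "continuous_on UNIV (T0 u)" for u :: "real \<Rightarrow>\<^sub>C 'a"
  proof -
    have "continuous_on {-e..e} (\<lambda>c. integral {-e..c} (\<lambda>r. F (u r)))"
      by (intro indefinite_integral_continuous_1 integrable_continuous_real cFu)
    then have "continuous_on UNIV (\<lambda>t. integral {-e..cl t} (\<lambda>r. F (u r)))"
      by (rule continuous_on_compose2) (use cl in \<open>auto simp: cl_def intro!: continuous_intros\<close>)
    then show ?thesis unfolding T0_def by (intro continuous_intros)
  qed
  define T where "T u = Bcontfun (T0 (apply_bcontfun u))" for u
  have T: "apply_bcontfun (T u) = T0 u" if "u \<in> S" for u
  proof -
    have "norm (T0 u t) \<le> norm b + 1" for t
      using T0_b[OF that, of t] norm_triangle_ineq2[of "T0 u t" b] by simp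
    then have "T0 u \<in> bcontfun"
      using T0_cont bcontfun_normI by blast
    then show ?thesis by (simp add: T_def Bcontfun_inverse)
  qed
  have "\<exists>!u\<in>S. T u = u"
  proof (rule Banach_fix)
    show "complete S"
      unfolding complete_eq_closed S_def by (intro closed_PiC) (simp add: B_def)
    have "const_bcontfun b \<in> S"
      by (simp add: S B_def const_bcontfun.rep_eq)
    then show "S \<noteq> {}" by blast
    show "0 \<le> 3 * e * L" "3 * e * L < 1" using e L0 by auto
    show "T ` S \<subseteq> S"
      using T T0_b by (auto simp: S B_def dist_norm norm_minus_commute)
    fix u v assume uv: "u \<in> S" "v \<in> S"
    show "dist (T u) (T v) \<le> 3 * e * L * dist u v"
    proof (rule dist_bound)
      fix t
      define f where "f r = F (u r) - F (v r)" for r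
      have f: "continuous_on X f" for X unfolding f_def by (intro continuous_intros cFu)
      have f_le: "norm (f r) \<le> L * dist u v" for r
      proof -
        have "norm (f r) \<le> L * norm (u r - v r)"
          unfolding f_def using uv by (intro lipschitz_on_normD[OF L]) (auto simp: S)
        also have "\<dots> \<le> L * dist u v"
          using L0 dist_bounded[of u r v] by (intro mult_left_mono) (auto simp: dist_norm)
        finally show ?thesis .
      qed
      have diff: "integral {-e..c} f = integral {-e..c} (\<lambda>r. F (u r)) - integral {-e..c} (\<lambda>r. F (v r))" for c
        unfolding f_def by (intro integral_diff integrable_continuous_real cFu)
      have "dist (T u t) (T v t) = norm (integral {-e..cl t} f - integral {-e..0} f)"
        using uv by (simp add: T dist_norm T0_def diff algebra_simps)
      also have "\<dots> \<le> L * dist u v * (2 * e) + L * dist u v * e"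
        by (intro order_trans[OF norm_triangle_ineq4] add_mono int_le int_le0 cl f f_le)
      finally show "dist (T u t) (T v t) \<le> 3 * e * L * dist u v"
        by (simp add: algebra_simps)
    qed
  qed
  then obtain u where u: "u \<in> S" "T u = u" by blast
  then have ueq: "u t = T0 u t" for t using T by metis
  have "(apply_bcontfun u has_vector_derivative F (u t)) (at t)" if t: "t \<in> {-e<..<e}" for t
  proof -
    have "((\<lambda>c. integral {-e..c} (\<lambda>r. F (u r))) has_vector_derivative F (u t)) (at t within {-e..e})"
      by (rule integral_has_vector_derivative[OF cFu]) (use t in auto)
    then have "((\<lambda>c. integral {-e..c} (\<lambda>r. F (u r))) has_vector_derivative F (u t)) (at t)"
      using t at_within_Icc_at[of "-e" t e] by simp
    then have "((\<lambda>c. b + integral {-e..c} (\<lambda>r. F (u r)) - integral {-e..0} (\<lambda>r. F (u r)))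
        has_vector_derivative F (u t)) (at t)"
      using has_vector_derivative_add[OF has_vector_derivative_const[of b], of _ "F (u t)"]
        has_vector_derivative_diff[OF _ has_vector_derivative_const, of _ "F (u t)"] by fastforce
    then show ?thesis
    proof (rule has_vector_derivative_transform_within_open)
      fix r assume "r \<in> {-e<..<e}"
      then have "T0 u r = b + integral {-e..r} (\<lambda>r. F (u r)) - integral {-e..0} (\<lambda>r. F (u r))"
        using cl(2)[of r] by (simp add: T0_def)
      then show "b + integral {-e..r} (\<lambda>r. F (u r)) - integral {-e..0} (\<lambda>r. F (u r)) = u r"
        using ueq[of r] by metis
    qed (use t in auto)
  qed
  then have "autonomous_solution F u {-e<..<e}"
    using e by (auto simp: autonomous_solution_def is_interval_oo)
  moreover have "u 0 = b"
    using e by (subst ueq) (simp add: T0_def cl)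
  ultimately show thesis using that e by blast
qed

text \<open>By uniqueness all solutions with value \<open>b\<close> at time 0 agree on common
  domains, so they glue to one solution on the union \<open>U\<close>. Any extension of it belongs
  to the same family and so lives inside \<open>U\<close>.\<close>

lemma maximal_solution_exists:
  fixes F :: "'a::euclidean_space \<Rightarrow> 'a"
  assumes F: "bounded_lipschitz F"
  obtains z I where "maximal_solution F z I" "0 \<in> I" "z 0 = b"
proof -
  define A where "A = {(z, I). autonomous_solution F z I \<and> 0 \<in> I \<and> z 0 = b}"
  define U where "U = (\<Union>(z, I)\<in>A. I)"
  have U_I: "t \<in> U" if "(z, I) \<in> A" "t \<in> I" for z I t
    unfolding U_def by (rule UN_I[OF that(1)]) (use that(2) in simp)
  have agree: "z t = w t" if "(z, I) \<in> A" "(w, J) \<in> A" "t \<in> I" "t \<in> J" for z w I J t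
  proof -
    have "open (I \<inter> J)" "is_interval (I \<inter> J)" "0 \<in> I \<inter> J"
      using that by (auto simp: A_def autonomous_solution_def is_interval_Int)
    moreover have "autonomous_solution F z I" "autonomous_solution F w J" "z 0 = w 0"
      using that by (auto simp: A_def)
    ultimately have zw: "autonomous_solution F z (I \<inter> J)" "autonomous_solution F w (I \<inter> J)"
      by (auto simp: autonomous_solution_def)
    show ?thesis
      by (rule autonomous_solution_unique[OF F zw \<open>0 \<in> I \<inter> J\<close> \<open>z 0 = w 0\<close>]) (use that in simp)
  qed
  define p where "p t = (SOME q. q \<in> A \<and> t \<in> snd q)" for t
  define y where "y t = fst (p t) t" for t
  have y: "y t = z t" if "(z, I) \<in> A" "t \<in> I" for z I t
  proof -
    have "\<exists>q. q \<in> A \<and> t \<in> snd q"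
      using that by (intro exI[of _ "(z, I)"]) simp
    then have "p t \<in> A \<and> t \<in> snd (p t)"
      unfolding p_def by (rule someI_ex)
    then show ?thesis
      unfolding y_def using agree[of "fst (p t)" "snd (p t)" z I t] that by simp
  qed
  obtain e z0 where "e > 0" "z0 0 = b" "autonomous_solution F z0 {-e<..<e}"
    by (rule local_solution_exists[OF F])
  then have z0: "(z0, {-e<..<e}) \<in> A" by (simp add: A_def)
  then have "0 \<in> U" "y 0 = b"
    using y[OF z0, of 0] U_I[OF z0, of 0] \<open>e > 0\<close> \<open>z0 0 = b\<close> by auto
  have "autonomous_solution F y U"
    unfolding autonomous_solution_def
  proof (intro conjI ballI)
    show "open U"
      by (auto simp: U_def A_def autonomous_solution_def)
    \<comment> \<open>All the intervals contain 0, so their union is again an interval.\<close>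
    have "connected (\<Union>(snd ` A))"
      by (rule connected_Union) (auto simp: A_def autonomous_solution_def is_interval_connected)
    then show "is_interval U"
      by (simp add: U_def is_interval_connected_1 case_prod_beta)
    show "U \<noteq> {}" using \<open>0 \<in> U\<close> by blast
    fix t assume "t \<in> U"
    then obtain z I where zI: "(z, I) \<in> A" "t \<in> I" by (auto simp: U_def)
    then have "(z has_vector_derivative F (z t)) (at t)" "open I"
      by (auto simp: A_def autonomous_solution_def)
    then show "(y has_vector_derivative F (y t)) (at t)"
      using zI(2) y[OF zI(1)]
      by (metis has_vector_derivative_transform_within_open)
  qed
  moreover have "J = U"
    if "autonomous_solution F w J" "U \<subseteq> J" "\<forall>t\<in>U. w t = y t" for w J
  proof -
    have "(w, J) \<in> A"
      using that \<open>0 \<in> U\<close> \<open>y 0 = b\<close> by (auto simp: A_def)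
    then show ?thesis using that U_I[of w J] by auto
  qed
  ultimately have "maximal_solution F y U"
    unfolding maximal_solution_def by blast
  then show thesis using that \<open>0 \<in> U\<close> \<open>y 0 = b\<close> by blast
qed

lemma autonomous_solution_UNIV_maximal:
  assumes "autonomous_solution F z UNIV"
  shows "maximal_solution F z UNIV"
  using assms by (auto simp: maximal_solution_def)

lemma autonomous_solution_shift:
  assumes "autonomous_solution F z UNIV"
  shows "autonomous_solution F (\<lambda>t. z (t + s)) UNIV"
  unfolding autonomous_solution_def
proof (intro conjI ballI)
  fix t
  have "((\<lambda>t::real. t + s) has_vector_derivative 1) (at t)"
    by (auto intro!: derivative_eq_intros)
  from vector_diff_chain_at[OF this, of z "F (z (t + s))"] assms
  show "((\<lambda>t. z (t + s)) has_vector_derivative F (z (t + s))) (at t)"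
    by (simp add: autonomous_solution_def o_def)
qed auto

text \<open>For \<open>b \<noteq> 0\<close> the image of a maximal solution through \<open>b\<close>
  is a closed trajectory, that is, also the image of some global periodic solution; a time shift
  makes the latter start at \<open>b\<close>. For \<open>b = 0\<close> the constant solution serves,
  with the arbitrary period 1.\<close>

lemma global_center_periodic_solution:
  assumes F: "bounded_lipschitz F" and "global_center F"
  obtains z T where "autonomous_solution F z UNIV" "T > 0" "\<And>t. z (t + T) = z t" "z 0 = b"
proof (cases "b = 0")
  case True
  have "F 0 = 0" using assms by (simp add: global_center_def)
  then have "autonomous_solution F (\<lambda>_. 0) UNIV"
    by (auto simp: autonomous_solution_def)
  then show thesis using True that[of "\<lambda>_. 0" 1] by simp
next
  case False
  obtain w I where w: "maximal_solution F w I" "0 \<in> I" "w 0 = b"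
    by (rule maximal_solution_exists[OF F])
  then have "trajectory F (w ` I)" "b \<in> w ` I"
    by (auto simp: trajectory_def)
  then have "closed_trajectory F (w ` I)"
    using assms(2) False unfolding global_center_def by blast
  then obtain z T where z: "autonomous_solution F z UNIV" "T > 0" "\<And>t. z (t + T) = z t" "w ` I = range z"
    unfolding closed_trajectory_def by blast
  then obtain s where s: "z s = b" using \<open>b \<in> w ` I\<close> by auto
  show thesis
  proof (rule that[of "\<lambda>t. z (t + s)" T])
    show "z (t + T + s) = z (t + s)" for t
      using z(3)[of "t + s"] by (simp add: algebra_simps)
  qed (use z s in \<open>auto intro: autonomous_solution_shift\<close>)
qed

section \<open>Flows with periodic orbits\<close>

lemma infdist_lessE:
  fixes z :: "'a::metric_space"
  assumes "infdist z \<Gamma> < \<rho>" "\<Gamma> \<noteq> {}"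
  obtains w where "w \<in> \<Gamma>" "dist z w < \<rho>"
  using assms cInf_lessD[of "(\<lambda>a. dist z a) ` \<Gamma>" \<rho>] by (auto simp: infdist_notempty)

text \<open>Only the individual solutions are described here. The group law follows from uniqueness
  and joint continuity from Gronwall's inequality. The period may vary with the point and need not
  be minimal, so equilibria are included.\<close>

locale periodic_flow =
  fixes F :: "'a::euclidean_space \<Rightarrow> 'a" and \<Phi> :: "real \<Rightarrow> 'a \<Rightarrow> 'a"
  assumes lip: "bounded_lipschitz F"
    and flow_0 [simp]: "\<Phi> 0 z = z"
    and flow_deriv: "((\<lambda>t. \<Phi> t z) has_vector_derivative F (\<Phi> t z)) (at t)"
    and flow_periodic: "\<exists>T>0. \<forall>t. \<Phi> (t + T) z = \<Phi> t z"
begin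

lemma flow_solution: "autonomous_solution F (\<lambda>t. \<Phi> t z) UNIV"
  by (simp add: autonomous_solution_def flow_deriv)

lemma flow_add: "\<Phi> s (\<Phi> t z) = \<Phi> (s + t) z"
  using autonomous_solution_unique[OF lip flow_solution[of "\<Phi> t z"]
      autonomous_solution_shift[OF flow_solution[of z], of t], of 0 s] by simp

lemma flow_continuous: "continuous_on S (\<lambda>t. \<Phi> t z)"
proof -
  have "isCont (\<lambda>t. \<Phi> t z) t" for t
    using flow_deriv has_vector_derivative_continuous by blast
  then show ?thesis by (simp add: continuous_at_imp_continuous_on)
qed

lemma flow_eq_backward: "\<Phi> t z = w \<Longrightarrow> z = \<Phi> (- t) w"
  using flow_add[of "-t" t z] by auto

lemma flow_period_iff: "(\<forall>t. \<Phi> (t + T) z = \<Phi> t z) \<longleftrightarrow> \<Phi> T z = z"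
  using flow_add[of _ T z] flow_0 by (metis add_0)

definition orbit :: "'a \<Rightarrow> 'a set" where
  "orbit z = range (\<lambda>t. \<Phi> t z)"

lemma flow_in_orbit [simp]: "\<Phi> t z \<in> orbit z"
  by (simp add: orbit_def)

lemma self_in_orbit [simp]: "z \<in> orbit z"
  using flow_in_orbit[of 0 z] by simp

lemma orbit_flow_iff: "\<Phi> t w \<in> orbit z \<longleftrightarrow> w \<in> orbit z"
proof
  assume "\<Phi> t w \<in> orbit z"
  then obtain s where "\<Phi> t w = \<Phi> s z" by (auto simp: orbit_def)
  then have "w = \<Phi> (- t + s) z"
    using flow_eq_backward flow_add by metis
  then show "w \<in> orbit z" by simp
qed (auto simp: orbit_def flow_add)

lemma period_orbit:
  assumes "\<Phi> T z = z" "w \<in> orbit z"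
  shows "\<Phi> T w = w"
proof -
  obtain t where t: "w = \<Phi> t z" using assms(2) by (auto simp: orbit_def)
  have "\<Phi> T w = \<Phi> t (\<Phi> T z)" by (simp add: t flow_add add.commute)
  then show ?thesis using assms t by simp
qed

lemma flow_period_multiple:
  assumes "\<Phi> T z = z"
  shows "\<Phi> (t + of_int n * T) z = \<Phi> t z"
proof -
  have nat: "\<Phi> (real k * T) z = z" for k
  proof (induction k)
    case (Suc k)
    have "\<Phi> (real (Suc k) * T) z = \<Phi> T (\<Phi> (real k * T) z)"
      by (simp add: flow_add algebra_simps)
    then show ?case using Suc assms by simp
  qed simp
  have "\<Phi> (of_int n * T) z = z"
  proof (cases n rule: int_cases2)
    case (nonneg k)
    then show ?thesis using nat[of k] by simp
  next
    case (nonpos k)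
    then show ?thesis using flow_eq_backward[OF nat[of k]] by simp
  qed
  then show ?thesis using flow_add[of t "of_int n * T" z] by simp
qed

lemma flow_reduce_time:
  assumes "\<Phi> T z = z" "T > 0"
  obtains s where "0 \<le> s" "s < T" "\<Phi> t z = \<Phi> s z"
proof
  define s where "s = t + of_int (- \<lfloor>t / T\<rfloor>) * T"
  have "of_int \<lfloor>t / T\<rfloor> * T \<le> t / T * T" "t / T * T < (of_int \<lfloor>t / T\<rfloor> + 1) * T"
    using assms(2) by (intro mult_right_mono mult_strict_right_mono; linarith)+
  then show "0 \<le> s" "s < T"
    using assms(2) by (simp_all add: s_def algebra_simps)
  show "\<Phi> t z = \<Phi> s z"
    unfolding s_def by (rule flow_period_multiple[OF assms(1), symmetric])
qed

lemma compact_orbit: "compact (orbit z)"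
proof -
  obtain T where T: "T > 0" "\<Phi> T z = z"
    using flow_periodic[of z] flow_period_iff by blast
  have "orbit z = (\<lambda>t. \<Phi> t z) ` {0..T}"
  proof
    show "orbit z \<subseteq> (\<lambda>t. \<Phi> t z) ` {0..T}"
    proof
      fix w assume "w \<in> orbit z"
      then obtain t where "w = \<Phi> t z" by (auto simp: orbit_def)
      moreover obtain s where "0 \<le> s" "s < T" "\<Phi> t z = \<Phi> s z"
        by (rule flow_reduce_time[OF T(2,1)])
      ultimately show "w \<in> (\<lambda>t. \<Phi> t z) ` {0..T}" by auto
    qed
  qed (auto simp: orbit_def)
  then show ?thesis
    by (simp add: compact_continuous_image flow_continuous)
qed

text \<open>Transfers estimates for forward time to backward time.\<close>

lemma periodic_flow_reverse: "periodic_flow (\<lambda>z. - F z) (\<lambda>t. \<Phi> (- t))"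
proof
  show "bounded_lipschitz (\<lambda>z. - F z)" by (rule bounded_lipschitz_minus[OF lip])
  show "\<Phi> (- 0) z = z" for z by simp
  show "((\<lambda>t. \<Phi> (- t) z) has_vector_derivative - F (\<Phi> (- t) z)) (at t)" for z t
    by (rule has_vector_derivative_reflect) (rule flow_deriv)
  fix z
  obtain T where T: "T > 0" "\<Phi> T z = z"
    using flow_periodic[of z] flow_period_iff by blast
  have "\<Phi> (- (t + T)) z = \<Phi> (- t) z" for t
    using flow_period_multiple[OF T(2), of "- t" "- 1"] by simp
  then show "\<exists>T>0. \<forall>t. \<Phi> (- (t + T)) z = \<Phi> (- t) z" using T(1) by blast
qed

section \<open>Lipschitz dependence on the initial point near a compact invariant set\<close>

lemma flow_dist_le:
  assumes L: "L-lipschitz_on X F" and t: "0 \<le> t"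
    and X: "\<And>r. r \<in> {0..t} \<Longrightarrow> \<Phi> r z \<in> X" "\<And>r. r \<in> {0..t} \<Longrightarrow> \<Phi> r w \<in> X"
  shows "dist (\<Phi> t z) (\<Phi> t w) \<le> dist z w * exp (L * t)"
proof -
  have "norm (\<Phi> t z - \<Phi> t w)
      \<le> (norm (\<Phi> 0 z - \<Phi> 0 w) + integral {0..t} (\<lambda>r. norm (0::'a))) * exp (L * (t - 0))"
    by (rule perturbed_solution_dist_le[OF L])
      (use X t in \<open>auto intro: has_vector_derivative_at_within[OF flow_deriv]\<close>)
  then show ?thesis by (simp add: dist_norm)
qed

text \<open>Look at the first time \<open>s\<close> at which the distance is at least 1. By
  continuity it is at most 1 up to and including \<open>s\<close>, so both arcs stay where
  \<open>F\<close> is \<open>L\<close>-Lipschitz, and Gronwall's inequality together with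
  \<open>near\<close> gives a distance below 1 at \<open>s\<close>, a contradiction.\<close>

lemma flow_stays_near_forward:
  assumes L: "L-lipschitz_on {z. infdist z \<Gamma> \<le> 1} F"
    and w: "\<And>r. \<Phi> r w \<in> \<Gamma>" and near: "dist z w * exp (L * T) < 1" and t: "t \<in> {0..T}"
  shows "dist (\<Phi> t z) (\<Phi> t w) < 1"
proof (rule ccontr)
  assume "\<not> dist (\<Phi> t z) (\<Phi> t w) < 1"
  define d where "d r = dist (\<Phi> r z) (\<Phi> r w)" for r
  have cd: "continuous_on S d" for S
    unfolding d_def by (intro continuous_intros flow_continuous)
  have L0: "0 \<le> L" using L lipschitz_on_nonneg by blast
  have d0: "d 0 < 1"
  proof -
    have "dist z w * 1 \<le> dist z w * exp (L * T)"
      using L0 t by (intro mult_left_mono) auto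
    then show ?thesis using near by (simp add: d_def)
  qed
  define E where "E = {0..t} \<inter> d -` {1..}"
  have "compact E"
    unfolding E_def by (intro compact_Int_closed compact_Icc closed_vimage_Int)
      (rule continuous_closed_vimage, simp, use cd[of UNIV] in \<open>simp add: continuous_on_eq_continuous_at\<close>)
  moreover have "t \<in> E" using t \<open>\<not> _\<close> by (simp add: E_def d_def)
  ultimately obtain s where s: "s \<in> E" "\<And>r. r \<in> E \<Longrightarrow> s \<le> r"
    using compact_attains_inf[of E] by blast
  have lt: "d r < 1" if "0 \<le> r" "r < s" for r
    using s(2)[of r] s(1) that by (force simp: E_def)
  have "s > 0" using s(1) d0 by (cases "s = 0") (auto simp: E_def)
  have "d s \<le> 1"
  proof (rule continuous_le_on_closure[of "{0..<s}" d s 1])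
    show "continuous_on (closure {0..<s}) d" by (rule cd)
    show "s \<in> closure {0..<s}" using \<open>s > 0\<close> by simp
    fix r assume "r \<in> {0..<s}"
    then show "d r \<le> 1" using lt[of r] by simp
  qed
  then have le: "d r \<le> 1" if "r \<in> {0..s}" for r
    using lt[of r] that by (cases "r = s") auto
  have "d s \<le> dist z w * exp (L * s)"
    unfolding d_def
  proof (rule flow_dist_le[OF L])
    fix r assume r: "r \<in> {0..s}"
    show "\<Phi> r z \<in> {z. infdist z \<Gamma> \<le> 1}"
      using le[OF r] w[of r] infdist_le2[of "\<Phi> r w" \<Gamma> "\<Phi> r z" 1] by (simp add: d_def)
    show "\<Phi> r w \<in> {z. infdist z \<Gamma> \<le> 1}" using w by simp
  qed (use \<open>s > 0\<close> in simp)
  also have "\<dots> \<le> dist z w * exp (L * T)"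
    using L0 s(1) t by (intro mult_left_mono) (auto simp: E_def intro!: mult_left_mono)
  finally show False using near s(1) by (simp add: E_def)
qed

lemma flow_lipschitz_near_forward:
  assumes \<Gamma>: "compact \<Gamma>" "\<Gamma> \<noteq> {}" "\<And>t z. z \<in> \<Gamma> \<Longrightarrow> \<Phi> t z \<in> \<Gamma>"
  obtains \<rho> K where "\<rho> > 0" "K \<ge> 1" "\<And>z w t. \<lbrakk>infdist z \<Gamma> < \<rho>; infdist w \<Gamma> < \<rho>; 0 \<le> t; t \<le> T\<rbrakk>
      \<Longrightarrow> dist (\<Phi> t z) (\<Phi> t w) \<le> K * dist z w"
proof -
  define X where "X = {z. infdist z \<Gamma> \<le> 1}"
  have "compact X" unfolding X_def using \<Gamma> by (intro compact_infdist_le) auto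
  then obtain L where L: "L-lipschitz_on X F"
    using bounded_lipschitzE[OF lip] compact_imp_bounded by blast
  have L0: "0 \<le> L" using L lipschitz_on_nonneg by blast
  \<comment> \<open>Keeps the exponent nonnegative when \<open>T\<close> is negative; the claim
    about \<open>t\<close> is then vacuous.\<close>
  define T' where "T' = max T 0"
  \<comment> \<open>Exactly small enough that the growth factor \<open>exp (L * T')\<close> leaves
    the distance to a point of \<open>\<Gamma>\<close> below 1.\<close>
  define \<rho> where "\<rho> = exp (- (L * T'))"
  have X: "\<Phi> t z \<in> X" if z: "infdist z \<Gamma> < \<rho>" and t: "t \<in> {0..T'}" for z t
  proof -
    obtain w where w: "w \<in> \<Gamma>" "dist z w < \<rho>"
      by (rule infdist_lessE[OF z \<Gamma>(2)])
    have "dist z w * exp (L * T') < \<rho> * exp (L * T')"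
      using w(2) by (intro mult_strict_right_mono) auto
    also have "\<dots> = 1" by (simp add: \<rho>_def flip: exp_add)
    finally have "dist (\<Phi> t z) (\<Phi> t w) < 1"
      using \<Gamma>(3) w(1) t by (intro flow_stays_near_forward[OF L[unfolded X_def]]) auto
    then show ?thesis
      using \<Gamma>(3)[OF w(1)] infdist_le2[of "\<Phi> t w" \<Gamma> "\<Phi> t z" 1] by (simp add: X_def)
  qed
  show thesis
  proof
    show "\<rho> > 0" by (simp add: \<rho>_def)
    show "exp (L * T') \<ge> 1" using L0 by (simp add: T'_def)
    fix z w t assume *: "infdist z \<Gamma> < \<rho>" "infdist w \<Gamma> < \<rho>" "0 \<le> t" "t \<le> T"
    have "dist (\<Phi> t z) (\<Phi> t w) \<le> dist z w * exp (L * t)"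
      by (rule flow_dist_le[OF L \<open>0 \<le> t\<close>]) (use * X in \<open>auto simp: T'_def\<close>)
    also have "\<dots> \<le> dist z w * exp (L * T')"
      using L0 * by (intro mult_left_mono) (auto simp: T'_def intro!: mult_left_mono)
    finally show "dist (\<Phi> t z) (\<Phi> t w) \<le> exp (L * T') * dist z w" by (simp add: mult.commute)
  qed
qed

lemma flow_lipschitz_near:
  assumes \<Gamma>: "compact \<Gamma>" "\<Gamma> \<noteq> {}" "\<And>t z. z \<in> \<Gamma> \<Longrightarrow> \<Phi> t z \<in> \<Gamma>"
  obtains \<rho> K where "\<rho> > 0" "K \<ge> 1" "\<And>z w t. \<lbrakk>infdist z \<Gamma> < \<rho>; infdist w \<Gamma> < \<rho>; \<bar>t\<bar> \<le> T\<rbrakk>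
      \<Longrightarrow> dist (\<Phi> t z) (\<Phi> t w) \<le> K * dist z w"
proof -
  obtain \<rho>1 K1 where 1: "\<rho>1 > 0" "K1 \<ge> 1" "\<And>z w t. \<lbrakk>infdist z \<Gamma> < \<rho>1; infdist w \<Gamma> < \<rho>1; 0 \<le> t; t \<le> T\<rbrakk>
      \<Longrightarrow> dist (\<Phi> t z) (\<Phi> t w) \<le> K1 * dist z w"
    using flow_lipschitz_near_forward[OF \<Gamma>] by metis
  interpret rev: periodic_flow "\<lambda>z. - F z" "\<lambda>t. \<Phi> (- t)" by (rule periodic_flow_reverse)
  obtain \<rho>2 K2 where 2: "\<rho>2 > 0" "K2 \<ge> 1" "\<And>z w t. \<lbrakk>infdist z \<Gamma> < \<rho>2; infdist w \<Gamma> < \<rho>2; 0 \<le> t; t \<le> T\<rbrakk>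
      \<Longrightarrow> dist (\<Phi> (- t) z) (\<Phi> (- t) w) \<le> K2 * dist z w"
    using rev.flow_lipschitz_near_forward[OF \<Gamma>(1,2), of T] \<Gamma>(3) by metis
  show thesis
  proof
    show "min \<rho>1 \<rho>2 > 0" "max K1 K2 \<ge> 1" using 1 2 by auto
    fix z w t assume *: "infdist z \<Gamma> < min \<rho>1 \<rho>2" "infdist w \<Gamma> < min \<rho>1 \<rho>2" "\<bar>t\<bar> \<le> T"
    have "dist (\<Phi> t z) (\<Phi> t w) \<le> K1 * dist z w \<or> dist (\<Phi> t z) (\<Phi> t w) \<le> K2 * dist z w"
      using * 1(3)[of z w t] 2(3)[of z w "- t"] by (cases "t \<ge> 0") auto
    moreover have "K1 * dist z w \<le> max K1 K2 * dist z w" "K2 * dist z w \<le> max K1 K2 * dist z w"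
      by (simp_all add: mult_right_mono)
    ultimately show "dist (\<Phi> t z) (\<Phi> t w) \<le> max K1 K2 * dist z w" by linarith
  qed
qed

text \<open>Near \<open>(s, w)\<close> the flow is Lipschitz in the point with a constant that is
  uniform for \<open>\<bar>t\<bar> \<le> \<bar>s\<bar> + 1\<close>; moving first the point to
  \<open>w\<close> and then the time to \<open>s\<close> gives the two terms of the bound.\<close>

lemma flow_jointly_continuous: "continuous_on S (\<lambda>(t, z). \<Phi> t z)"
proof -
  have "isCont (\<lambda>(t, z). \<Phi> t z) (s, w)" for s w
  proof -
    obtain \<rho> K where \<rho>: "\<rho> > 0" "K \<ge> 1"
      and K: "\<And>z w' t. \<lbrakk>infdist z (orbit w) < \<rho>; infdist w' (orbit w) < \<rho>; \<bar>t\<bar> \<le> \<bar>s\<bar> + 1\<rbrakk>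
        \<Longrightarrow> dist (\<Phi> t z) (\<Phi> t w') \<le> K * dist z w'"
      using flow_lipschitz_near[OF compact_orbit[of w], of "\<bar>s\<bar> + 1"] orbit_flow_iff self_in_orbit
      by (metis empty_iff)
    let ?F = "at (s, w)"
    have fst: "((\<lambda>p. fst p) \<longlongrightarrow> s) ?F" and snd: "((\<lambda>p. snd p) \<longlongrightarrow> w) ?F"
      using tendsto_fst[OF tendsto_ident_at] tendsto_snd[OF tendsto_ident_at] by fastforce+
    have "((\<lambda>t. \<Phi> t w) \<longlongrightarrow> \<Phi> s w) (at s)"
      using flow_continuous[of UNIV w] by (simp add: continuous_on_def)
    then have "((\<lambda>p. \<Phi> (fst p) w) \<longlongrightarrow> \<Phi> s w) ?F"
      using fst isCont_tendsto_compose[of s "\<lambda>t. \<Phi> t w"] by (simp add: isCont_def)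
    then have "((\<lambda>p. K * dist (snd p) w + dist (\<Phi> (fst p) w) (\<Phi> s w)) \<longlongrightarrow>
        K * dist w w + dist (\<Phi> s w) (\<Phi> s w)) ?F"
      by (intro tendsto_intros snd)
    then have lim: "((\<lambda>p. K * dist (snd p) w + dist (\<Phi> (fst p) w) (\<Phi> s w)) \<longlongrightarrow> 0) ?F"
      by simp
    have "\<forall>\<^sub>F p in ?F. dist (fst p) s < 1" "\<forall>\<^sub>F p in ?F. dist (snd p) w < \<rho>"
      using tendstoD[OF fst] tendstoD[OF snd \<open>\<rho> > 0\<close>] by auto
    then have "\<forall>\<^sub>F p in ?F. norm (dist (\<Phi> (fst p) (snd p)) (\<Phi> s w))
        \<le> K * dist (snd p) w + dist (\<Phi> (fst p) w) (\<Phi> s w)"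
    proof eventually_elim
      case (elim p)
      then have "infdist (snd p) (orbit w) < \<rho>" "\<bar>fst p\<bar> \<le> \<bar>s\<bar> + 1"
        using infdist_le[OF self_in_orbit[of w], of "snd p"] by (auto simp: dist_real_def)
      then have "dist (\<Phi> (fst p) (snd p)) (\<Phi> (fst p) w) \<le> K * dist (snd p) w"
        using K \<rho>(1) by simp
      then show ?case
        using dist_triangle[of "\<Phi> (fst p) (snd p)" "\<Phi> s w" "\<Phi> (fst p) w"] by simp
    qed
    from Lim_null_comparison[OF this lim]
    have "((\<lambda>p. \<Phi> (fst p) (snd p)) \<longlongrightarrow> \<Phi> s w) ?F"
      by (subst tendsto_dist_iff)
    then show ?thesis
      by (simp add: isCont_def case_prod_beta')
  qed
  then show ?thesis by (intro continuous_at_imp_continuous_on) auto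
qed

lemma flow_continuous_intro [continuous_intros]:
  assumes "continuous_on S f" "continuous_on S g"
  shows "continuous_on S (\<lambda>x. \<Phi> (f x) (g x))"
  using continuous_on_compose2[OF flow_jointly_continuous[of UNIV] continuous_on_Pair[OF assms]] by simp

end

section \<open>Return maps in the plane\<close>

text \<open>Let \<open>m\<close> be the least element of \<open>A\<close> in \<open>{0..s}\<close>.
  Its image is not below \<open>m\<close>, so by the intermediate value theorem some
  \<open>x \<le> m\<close> has \<open>Q x = m\<close>. Invariance puts \<open>x\<close> in
  \<open>A\<close>, and minimality forces \<open>x = m\<close>.\<close>

lemma increasing_map_fixed_point_in_invariant_set:
  fixes Q :: "real \<Rightarrow> real"
  assumes cont: "continuous_on {0..s} Q" and mono: "strict_mono_on {0..s} Q" and Q0: "Q 0 = 0"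
    and A: "closed A" "\<And>x. x \<in> {0..s} \<Longrightarrow> Q x \<in> A \<longleftrightarrow> x \<in> A"
    and s: "s \<in> A" "0 \<le> s"
  obtains m where "m \<in> A" "m \<in> {0..s}" "Q m = m"
proof -
  have "compact ({0..s} \<inter> A)" "{0..s} \<inter> A \<noteq> {}"
    using A s by (auto simp: compact_Int_closed)
  then obtain m where m: "m \<in> {0..s} \<inter> A" "\<And>x. x \<in> {0..s} \<inter> A \<Longrightarrow> m \<le> x"
    using compact_attains_inf[of "{0..s} \<inter> A"] by metis
  show thesis
  proof (cases "m = 0")
    case True
    then show ?thesis using that m(1) Q0 by auto
  next
    case False
    then have "0 < Q m"
      using strict_mono_onD[OF mono, of 0 m] m(1) Q0 s by auto
    \<comment> \<open>If \<open>Q m\<close> has left \<open>{0..s}\<close> it exceeds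
      \<open>m\<close> anyway; otherwise it lies in \<open>A\<close>, and minimality
      applies.\<close>
    then have "m \<le> Q m"
      using m(2)[of "Q m"] A(2)[of m] m(1) by (cases "Q m \<le> s") auto
    then obtain x where x: "0 \<le> x" "x \<le> m" "Q x = m"
      using IVT'[of Q 0 m m] Q0 m(1) continuous_on_subset[OF cont, of "{0..m}"] by auto
    then have "x = m"
      using m A(2)[of x] by force
    then show ?thesis using that m(1) x(3) by blast
  qed
qed

text \<open>The map \<open>P\<close> may reverse orientation, but its square is increasing. The minimal element of
  an invariant set on one side of 0 must then be fixed by the square.\<close>

lemma injective_map_return_of_order_two:
  fixes P :: "real \<Rightarrow> real"
  assumes d: "d > 0" and cont: "continuous_on {-d..d} P" and inj: "inj_on P {-d..d}" and P0: "P 0 = 0"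
  obtains e where "e > 0"
    "\<And>A s. \<lbrakk>closed A; \<And>x. x \<in> {-d..d} \<Longrightarrow> P x \<in> A \<longleftrightarrow> x \<in> A; s \<in> A; \<bar>s\<bar> \<le> e\<rbrakk>
      \<Longrightarrow> \<exists>m\<in>A. m \<in> {-d..d} \<and> P m \<in> {-d..d} \<and> P (P m) = m"
proof -
  \<comment> \<open>\<open>P\<close> need not map its domain into itself; \<open>e\<close> is taken
    so small that \<open>P\<close> can be applied twice to points within \<open>e\<close> of
    0.\<close>
  have "open ({-d<..<d} \<inter> P -` {-d<..<d})"
    by (rule continuous_open_preimage) (auto intro: continuous_on_subset[OF cont])
  moreover have "0 \<in> {-d<..<d} \<inter> P -` {-d<..<d}" using d P0 by simp
  ultimately obtain e where e: "e > 0" "cball 0 e \<subseteq> {-d<..<d} \<inter> P -` {-d<..<d}"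
    using open_contains_cball by metis
  have dom: "x \<in> {-d..d}" "P x \<in> {-d..d}" if "\<bar>x\<bar> \<le> e" for x
    using that e(2) by (auto simp: subset_iff)
  define Q where "Q x = P (P x)" for x
  have cQ: "continuous_on {-e..e} Q"
    unfolding Q_def using dom
    by (intro continuous_on_compose2[OF cont] continuous_on_subset[OF cont]) auto
  have "strict_mono_on {-d..d} P \<or> strict_antimono_on {-d..d} P"
    using injective_eq_monotone_map[of "{-d..d}" P] cont inj by (simp add: is_interval_cc)
  then have mQ: "Q x < Q y" if "x \<in> {-e..e}" "y \<in> {-e..e}" "x < y" for x y
    using that dom[of x] dom[of y] unfolding Q_def
    by (auto simp: monotone_on_def)
  show thesis
  proof (rule that)
    show "e > 0" by fact
    fix A s assume A: "closed A" "\<And>x. x \<in> {-d..d} \<Longrightarrow> P x \<in> A \<longleftrightarrow> x \<in> A" and s: "s \<in> A" "\<bar>s\<bar> \<le> e"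
    have QA: "Q x \<in> A \<longleftrightarrow> x \<in> A" if "\<bar>x\<bar> \<le> e" for x
      using A(2)[OF dom(1)[OF that]] A(2)[OF dom(2)[OF that]] by (simp add: Q_def)
    have "\<exists>m\<in>A. \<bar>m\<bar> \<le> e \<and> Q m = m"
    proof (cases "s \<ge> 0")
      case True
      obtain m where "m \<in> A" "m \<in> {0..s}" "Q m = m"
      proof (rule increasing_map_fixed_point_in_invariant_set[of s Q A])
        show "continuous_on {0..s} Q" by (rule continuous_on_subset[OF cQ]) (use s in auto)
        show "strict_mono_on {0..s} Q" using mQ s by (auto simp: monotone_on_def)
        show "Q 0 = 0" by (simp add: Q_def P0)
      qed (use A QA s True in auto)
      then show ?thesis using s by (intro bexI[of _ m]) auto
    next
      case False
      \<comment> \<open>The negative side is reflected onto the positive one by conjugating with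
        \<open>uminus\<close>.\<close>
      obtain m where "m \<in> uminus ` A" "m \<in> {0..-s}" "- Q (- m) = m"
      proof (rule increasing_map_fixed_point_in_invariant_set[of "-s" "\<lambda>x. - Q (- x)" "uminus ` A"])
        show "continuous_on {0..-s} (\<lambda>x. - Q (- x))"
          using s by (intro continuous_intros continuous_on_compose2[OF cQ]) auto
        show "strict_mono_on {0..-s} (\<lambda>x. - Q (- x))" using mQ s by (auto simp: monotone_on_def)
        show "- Q (- 0) = 0" by (simp add: Q_def P0)
        show "closed (uminus ` A)" by (rule closed_negations[OF A(1)])
        show "- Q (- x) \<in> uminus ` A \<longleftrightarrow> x \<in> uminus ` A" if "x \<in> {0..-s}" for x
          using QA[of "-x"] that s by (auto simp: image_iff minus_equation_iff[of x] equation_minus_iff[of x])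
      qed (use s False in auto)
      then show ?thesis using s by (intro bexI[of _ "-m"]) auto
    qed
    then show "\<exists>m\<in>A. m \<in> {-d..d} \<and> P m \<in> {-d..d} \<and> P (P m) = m"
      using dom by (auto simp: Q_def)
  qed
qed

text \<open>The vector \<open>n\<close> is \<open>v\<close> turned through a right angle. In the
  plane its multiples exhaust the orthogonal complement, so the transversal has one real coordinate
  and monotonicity arguments apply to the return map.\<close>

lemma real2_orthogonal_complement:
  fixes v :: "real ^ 2"
  assumes "v \<noteq> 0"
  obtains n where "n \<noteq> 0" "n \<bullet> v = 0" "\<And>w. w \<bullet> v = 0 \<Longrightarrow> w = (w \<bullet> n / (n \<bullet> n)) *\<^sub>R n"
proof -
  define n :: "real ^ 2" where "n = vector [- (v $ 2), v $ 1]"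
  have n: "n $ 1 = - (v $ 2)" "n $ 2 = v $ 1" by (simp_all add: n_def)
  have "n \<noteq> 0" using assms n by (auto simp: vec_eq_iff forall_2)
  moreover have "n \<bullet> v = 0" by (simp add: inner_vec_def sum_2 n)
  moreover have "w = (w \<bullet> n / (n \<bullet> n)) *\<^sub>R n" if "w \<bullet> v = 0" for w
  proof -
    have 0: "w $ 1 * v $ 1 + w $ 2 * v $ 2 = 0"
      using that by (simp add: inner_vec_def sum_2)
    have "(n \<bullet> n) *\<^sub>R w = (w \<bullet> n) *\<^sub>R n"
      unfolding vec_eq_iff forall_2 using 0 by (simp add: inner_vec_def sum_2 n) algebra
    then have "(1 / (n \<bullet> n)) *\<^sub>R (n \<bullet> n) *\<^sub>R w = (1 / (n \<bullet> n)) *\<^sub>R (w \<bullet> n) *\<^sub>R n" by simp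
    then show ?thesis using \<open>n \<noteq> 0\<close> by simp
  qed
  ultimately show thesis using that by blast
qed

section \<open>Crossing times of a transversal\<close>

context periodic_flow
begin

lemma orbit_sym: "w \<in> orbit z \<Longrightarrow> z \<in> orbit w"
  using flow_eq_backward by (auto simp: orbit_def)

text \<open>An implicit function argument for the crossing time \<open>\<theta>\<close>. Near
  \<open>(0, a)\<close> the function \<open>l z t\<close>, whose zeros are the crossings of the line
  through \<open>a\<close> orthogonal to \<open>F a\<close>, grows in \<open>t\<close> at rate at
  least \<open>c\<close>. This yields existence, uniqueness and continuity of the crossing
  time.\<close>

lemma crossing_map:
  assumes "F a \<noteq> 0" "\<eta>0 > 0"
  obtains \<eta> \<rho> \<theta> where "0 < \<eta>" "\<eta> \<le> \<eta>0" "\<rho> > 0" "\<theta> a = 0" "continuous_on (ball a \<rho>) \<theta>"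
    "\<And>z. z \<in> ball a \<rho> \<Longrightarrow> \<bar>\<theta> z\<bar> \<le> \<eta> \<and> (\<Phi> (\<theta> z) z - a) \<bullet> F a = 0"
    "\<And>z t. \<lbrakk>z \<in> ball a \<rho>; \<bar>t\<bar> \<le> 2 * \<eta>; (z - a) \<bullet> F a = 0; (\<Phi> t z - a) \<bullet> F a = 0\<rbrakk> \<Longrightarrow> t = 0"
proof -
  define v where "v = F a"
  define c where "c = v \<bullet> v / 2"
  have "v \<noteq> 0" using assms by (simp add: v_def)
  then have "c > 0" "v \<bullet> v > c" by (simp_all add: c_def)
  define S where "S = (\<lambda>p. F (\<Phi> (fst p) (snd p)) \<bullet> v) -` {c<..}"
  have "continuous_on UNIV (\<lambda>p. F (\<Phi> (fst p) (snd p)) \<bullet> v)"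
    by (intro continuous_intros continuous_on_compose2[OF bounded_lipschitz_continuous[OF lip, of UNIV]]) auto
  then have "open S"
    unfolding S_def by (intro open_vimage) auto
  moreover have "(0, a) \<in> S"
    using \<open>v \<bullet> v > c\<close> by (simp add: S_def v_def)
  ultimately obtain A B where AB: "open A" "open B" "(0, a) \<in> A \<times> B" "A \<times> B \<subseteq> S"
    by (rule open_prod_elim)
  obtain r where r: "r > 0" "ball 0 r \<subseteq> A"
    using AB(1,3) open_contains_ball by (metis mem_Times_iff fst_conv)
  obtain \<rho>1 where \<rho>1: "\<rho>1 > 0" "ball a \<rho>1 \<subseteq> B"
    using AB(2,3) open_contains_ball by (metis mem_Times_iff snd_conv)
  \<comment> \<open>\<open>2 * \<eta> < r\<close> puts the window of length
    \<open>2 * \<eta>\<close> on each side of 0 into the region of growth. The double window is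
    needed because differences of two crossing times occur later.\<close>
  define \<eta> where "\<eta> = min \<eta>0 (r / 4)"
  have \<eta>: "0 < \<eta>" "\<eta> \<le> \<eta>0" "2 * \<eta> < r" using assms(2) r(1) by (auto simp: \<eta>_def)
  \<comment> \<open>By Cauchy-Schwarz this gives \<open>\<bar>l z 0\<bar> < c * \<eta>\<close>, so
    growth at rate \<open>c\<close> makes \<open>l z\<close> change sign within time
    \<open>\<eta>\<close>.\<close>
  define \<rho> where "\<rho> = min \<rho>1 (c * \<eta> / norm v)"
  have "\<rho> > 0" using \<rho>1 \<eta> \<open>c > 0\<close> \<open>v \<noteq> 0\<close> by (simp add: \<rho>_def)
  define l where "l z t = (\<Phi> t z - a) \<bullet> v" for z t
  have l': "(l z has_real_derivative F (\<Phi> t z) \<bullet> v) (at t)" for z t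
    unfolding l_def has_real_derivative_iff_has_vector_derivative
    using bounded_linear.has_vector_derivative[OF bounded_linear_inner_left
        has_vector_derivative_diff[OF flow_deriv has_vector_derivative_const]] by simp
  have mono: "c * (t - s) \<le> l z t - l z s"
    if "z \<in> ball a \<rho>" "- (2 * \<eta>) \<le> s" "s \<le> t" "t \<le> 2 * \<eta>" for z s t
  proof (cases "s = t")
    case False
    then have "s < t" using that by simp
    then obtain q where q: "s < q" "q < t" "l z t - l z s = (t - s) * (F (\<Phi> q z) \<bullet> v)"
      using MVT2[of s t "l z" "\<lambda>q. F (\<Phi> q z) \<bullet> v"] l' by blast
    have "(q, z) \<in> A \<times> B"
      using q that \<eta>(3) r(2) \<rho>1(2) by (auto simp: \<rho>_def subset_iff dist_real_def)
    then have "c \<le> F (\<Phi> q z) \<bullet> v" using AB(4) by (auto simp: S_def)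
    then show ?thesis using q that by (simp add: mult_left_mono mult.commute)
  qed simp
  have cross: "\<exists>t. \<bar>t\<bar> \<le> \<eta> \<and> l z t = 0" if "z \<in> ball a \<rho>" for z
  proof -
    have "norm (z - a) < c * \<eta> / norm v"
      using that by (simp add: \<rho>_def dist_norm norm_minus_commute)
    then have "norm (z - a) * norm v < c * \<eta>"
      using \<open>v \<noteq> 0\<close> by (simp add: field_simps)
    then have "\<bar>l z 0\<bar> < c * \<eta>"
      using Cauchy_Schwarz_ineq2[of "z - a" v] by (simp add: l_def)
    moreover have "c * \<eta> \<le> l z \<eta> - l z 0" "c * \<eta> \<le> l z 0 - l z (- \<eta>)"
      using mono[OF that, of 0 \<eta>] mono[OF that, of "-\<eta>" 0] \<eta> by simp_all
    ultimately have "l z (- \<eta>) \<le> 0" "0 \<le> l z \<eta>" by simp_all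
    moreover have "continuous_on {-\<eta>..\<eta>} (l z)"
      unfolding l_def by (intro continuous_intros)
    ultimately obtain t where "- \<eta> \<le> t" "t \<le> \<eta>" "l z t = 0"
      using IVT'[of "l z" "-\<eta>" 0 \<eta>] \<eta> by auto
    then show ?thesis by (intro exI[of _ t]) auto
  qed
  define \<theta> where "\<theta> z = (SOME t. \<bar>t\<bar> \<le> \<eta> \<and> l z t = 0)" for z
  have \<theta>: "\<bar>\<theta> z\<bar> \<le> \<eta>" "l z (\<theta> z) = 0" if "z \<in> ball a \<rho>" for z
    using someI_ex[OF cross[OF that]] by (simp_all add: \<theta>_def)
  have dist_le: "c * \<bar>t - s\<bar> \<le> \<bar>l z t - l z s\<bar>"
    if "z \<in> ball a \<rho>" "\<bar>s\<bar> \<le> 2 * \<eta>" "\<bar>t\<bar> \<le> 2 * \<eta>" for z s t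
  proof -
    have "- (2 * \<eta>) \<le> s" "- (2 * \<eta>) \<le> t" "s \<le> 2 * \<eta>" "t \<le> 2 * \<eta>" using that by linarith+
    then show ?thesis
      using mono[OF that(1), of s t] mono[OF that(1), of t s] by (cases "s \<le> t") auto
  qed
  have unique: "s = t" if "z \<in> ball a \<rho>" "\<bar>s\<bar> \<le> 2 * \<eta>" "\<bar>t\<bar> \<le> 2 * \<eta>" "l z s = 0" "l z t = 0" for z s t
    using dist_le[OF that(1-3)] that(4,5) \<open>c > 0\<close> by (simp add: mult_le_0_iff)
  have a: "a \<in> ball a \<rho>" using \<open>\<rho> > 0\<close> by simp
  have l0: "l z 0 = (z - a) \<bullet> v" for z by (simp add: l_def)
  have "isCont \<theta> z" if z: "z \<in> ball a \<rho>" for z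
  proof -
    have "isCont (\<lambda>w. l w (\<theta> z)) z"
    proof -
      have "continuous_on UNIV (\<lambda>w. l w (\<theta> z))" unfolding l_def by (intro continuous_intros)
      then show ?thesis by (simp add: continuous_on_eq_continuous_at)
    qed
    then have "((\<lambda>w. \<bar>l w (\<theta> z)\<bar> / c) \<longlongrightarrow> \<bar>l z (\<theta> z)\<bar> / c) (at z)"
      unfolding isCont_def using \<open>c > 0\<close> by (intro tendsto_intros) auto
    then have lim: "((\<lambda>w. \<bar>l w (\<theta> z)\<bar> / c) \<longlongrightarrow> 0) (at z)"
      using \<theta>(2)[OF z] by simp
    have "\<forall>\<^sub>F w in at z. w \<in> ball a \<rho>"
      using z by (intro eventually_at_in_open') auto
    \<comment> \<open>Since \<open>l w\<close> vanishes at \<open>\<theta> w\<close>, its value at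
      \<open>\<theta> z\<close> bounds the difference of the two crossing times; that value tends to
      \<open>l z (\<theta> z) = 0\<close>.\<close>
    then have "\<forall>\<^sub>F w in at z. norm (\<theta> w - \<theta> z) \<le> \<bar>l w (\<theta> z)\<bar> / c"
    proof eventually_elim
      case (elim w)
      have "c * \<bar>\<theta> w - \<theta> z\<bar> \<le> \<bar>l w (\<theta> w) - l w (\<theta> z)\<bar>"
        using \<theta>(1)[OF z] \<theta>(1)[OF elim] \<eta> by (intro dist_le elim) auto
      then show ?case using \<theta>(2)[OF elim] \<open>c > 0\<close> by (simp add: field_simps)
    qed
    from Lim_null_comparison[OF this lim] show ?thesis
      by (simp add: isCont_def Lim_null[of \<theta>])
  qed
  then have "continuous_on (ball a \<rho>) \<theta>" by (simp add: continuous_at_imp_continuous_on)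
  moreover have "\<theta> a = 0"
    using unique[OF a, of "\<theta> a" 0] \<theta>[OF a] \<eta> by (simp add: l0)
  moreover have "t = 0" if "z \<in> ball a \<rho>" "\<bar>t\<bar> \<le> 2 * \<eta>" "(z - a) \<bullet> F a = 0" "(\<Phi> t z - a) \<bullet> F a = 0" for z t
    using unique[OF that(1), of t 0] that \<eta> by (simp add: l_def v_def)
  ultimately show thesis
    using that[of \<eta> \<rho> \<theta>] \<eta> \<open>\<rho> > 0\<close> \<theta> by (simp add: l_def v_def)
qed

end

section \<open>Bounded periods near a closed orbit and a first integral\<close>

locale planar_periodic_flow = periodic_flow F \<Phi>
  for F :: "real ^ 2 \<Rightarrow> real ^ 2" and \<Phi> :: "real \<Rightarrow> real ^ 2 \<Rightarrow> real ^ 2"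
begin

text \<open>The return map \<open>P\<close> follows the flow for the period \<open>T\<close> of
  \<open>a\<close> and then corrects by the crossing time. For \<open>z\<close> near
  \<open>a\<close> the trace of its orbit on the transversal is closed and invariant under
  \<open>P\<close>, so it contains a point \<open>m\<close> with \<open>P (P m) = m\<close>. Two
  returns close the orbit of \<open>m\<close>, which is the orbit of \<open>z\<close>.\<close>

lemma period_bounded_near_point:
  assumes Fa: "F a \<noteq> 0" and T: "T > 0" "\<Phi> T a = a"
  obtains \<rho> where "\<rho> > 0" "\<And>z. z \<in> ball a \<rho> \<Longrightarrow> \<exists>\<tau>. 0 < \<tau> \<and> \<tau> \<le> 3 * T \<and> \<Phi> \<tau> z = z"
proof -
  obtain \<eta> \<rho> \<theta> where \<eta>: "0 < \<eta>" "\<eta> \<le> T / 4" and \<rho>: "\<rho> > 0" and \<theta>a: "\<theta> a = 0"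
    and c\<theta>: "continuous_on (ball a \<rho>) \<theta>"
    and \<theta>: "\<And>z. z \<in> ball a \<rho> \<Longrightarrow> \<bar>\<theta> z\<bar> \<le> \<eta> \<and> (\<Phi> (\<theta> z) z - a) \<bullet> F a = 0"
    and unique: "\<And>z t. \<lbrakk>z \<in> ball a \<rho>; \<bar>t\<bar> \<le> 2 * \<eta>; (z - a) \<bullet> F a = 0; (\<Phi> t z - a) \<bullet> F a = 0\<rbrakk> \<Longrightarrow> t = 0"
    using crossing_map[OF Fa, of "T / 4"] T(1) by (metis zero_less_divide_iff zero_less_numeral)
  obtain n where n: "n \<noteq> 0" "n \<bullet> F a = 0" "\<And>w. w \<bullet> F a = 0 \<Longrightarrow> w = (w \<bullet> n / (n \<bullet> n)) *\<^sub>R n"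
    using real2_orthogonal_complement[OF Fa] by metis
  \<comment> \<open>\<open>\<psi>\<close> parametrizes the transversal, \<open>q\<close> recovers
    the coordinate, and \<open>\<pi>\<close> slides a point along its orbit onto the
    transversal.\<close>
  define \<psi> where "\<psi> x = a + x *\<^sub>R n" for x :: real
  define q where "q z = (z - a) \<bullet> n / (n \<bullet> n)" for z
  have \<psi>q: "\<psi> (q z) = z" if "(z - a) \<bullet> F a = 0" for z
    using n(3)[OF that] by (simp add: \<psi>_def q_def)
  have q\<psi>: "q (\<psi> x) = x" for x using n(1) by (simp add: \<psi>_def q_def)
  have \<psi>_section: "(\<psi> x - a) \<bullet> F a = 0" for x by (simp add: \<psi>_def n(2))
  have c\<psi>: "continuous_on X \<psi>" for X unfolding \<psi>_def by (intro continuous_intros)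
  define \<pi> where "\<pi> z = \<Phi> (\<theta> z) z" for z
  have c\<pi>: "continuous_on (ball a \<rho>) \<pi>" unfolding \<pi>_def by (intro continuous_intros c\<theta>)
  have cq: "continuous_on X (\<lambda>x. q (f x))" if "continuous_on X f" for X :: "'b::topological_space set" and f
    unfolding q_def using n(1) that by (intro continuous_intros) auto
  define P where "P x = q (\<pi> (\<Phi> T (\<psi> x)))" for x
  define U where "U = \<psi> -` ball a \<rho> \<inter> (\<lambda>x. \<Phi> T (\<psi> x)) -` ball a \<rho>"
  have "open U"
    unfolding U_def by (intro open_Int open_vimage continuous_intros c\<psi>) auto
  moreover have "0 \<in> U" using T \<rho> by (simp add: U_def \<psi>_def)
  ultimately obtain d where d: "d > 0" "cball 0 d \<subseteq> U" using open_contains_cball by blast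
  have dom: "\<psi> x \<in> ball a \<rho>" "\<Phi> T (\<psi> x) \<in> ball a \<rho>" if "x \<in> {-d..d}" for x
    using that d(2) by (auto simp: U_def subset_iff)
  have P: "\<psi> (P x) = \<Phi> (\<theta> (\<Phi> T (\<psi> x)) + T) (\<psi> x)" "\<bar>\<theta> (\<Phi> T (\<psi> x))\<bar> \<le> \<eta>" if "x \<in> {-d..d}" for x
    using \<psi>q[of "\<pi> (\<Phi> T (\<psi> x))"] \<theta>[OF dom(2)[OF that]] by (simp_all add: P_def \<pi>_def flow_add)
  have cP: "continuous_on {-d..d} P"
    unfolding P_def using dom by (intro cq continuous_on_compose2[OF c\<pi>] continuous_intros c\<psi>) auto
  \<comment> \<open>Points with the same return lie on one orbit, at a time difference of at most
    \<open>2 * \<eta>\<close>. Both are on the transversal, so the difference is 0.\<close>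
  have iP: "inj_on P {-d..d}"
  proof (rule inj_onI)
    fix x y assume xy: "x \<in> {-d..d}" "y \<in> {-d..d}" "P x = P y"
    define s where "s = \<theta> (\<Phi> T (\<psi> x))"
    define t where "t = \<theta> (\<Phi> T (\<psi> y))"
    have "\<Phi> (s + T) (\<psi> x) = \<Phi> (t + T) (\<psi> y)"
      using P(1)[OF xy(1)] P(1)[OF xy(2)] xy(3) by (simp add: s_def t_def)
    then have "\<psi> y = \<Phi> (- (t + T)) (\<Phi> (s + T) (\<psi> x))"
      using flow_eq_backward by metis
    then have eq: "\<psi> y = \<Phi> (s - t) (\<psi> x)" by (simp add: flow_add)
    have "\<bar>s - t\<bar> \<le> 2 * \<eta>"
      using P(2)[OF xy(1)] P(2)[OF xy(2)] by (simp add: s_def t_def)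
    then have "s - t = 0"
      using unique[OF dom(1)[OF xy(1)]] \<psi>_section eq by metis
    then show "x = y" using eq q\<psi> flow_0 by metis
  qed
  have P0: "P 0 = 0" using T \<theta>a by (simp add: P_def \<psi>_def \<pi>_def q_def)
  obtain e where e: "e > 0"
    "\<And>A s. \<lbrakk>closed A; \<And>x. x \<in> {-d..d} \<Longrightarrow> P x \<in> A \<longleftrightarrow> x \<in> A; s \<in> A; \<bar>s\<bar> \<le> e\<rbrakk>
      \<Longrightarrow> \<exists>m\<in>A. m \<in> {-d..d} \<and> P m \<in> {-d..d} \<and> P (P m) = m"
    using injective_map_return_of_order_two[OF d(1) cP iP P0] by metis
  have "open (ball a \<rho> \<inter> (\<lambda>z. q (\<pi> z)) -` {-e<..<e})"
    by (intro continuous_open_preimage cq c\<pi>) auto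
  moreover have "a \<in> ball a \<rho> \<inter> (\<lambda>z. q (\<pi> z)) -` {-e<..<e}"
    using \<rho> e(1) by (simp add: \<pi>_def \<theta>a q_def)
  ultimately obtain \<rho>' where \<rho>': "\<rho>' > 0" "ball a \<rho>' \<subseteq> ball a \<rho> \<inter> (\<lambda>z. q (\<pi> z)) -` {-e<..<e}"
    using open_contains_ball by blast
  show thesis
  proof (rule that[OF \<rho>'(1)])
    fix z assume "z \<in> ball a \<rho>'"
    then have "z \<in> ball a \<rho> \<inter> (\<lambda>z. q (\<pi> z)) -` {-e<..<e}" using \<rho>'(2) by blast
    then have z: "z \<in> ball a \<rho>" "\<bar>q (\<pi> z)\<bar> \<le> e" by auto
    \<comment> \<open>Closed because orbits are compact, and invariant in both directions because
      \<open>P\<close> moves points along their orbits.\<close>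
    define A where "A = \<psi> -` orbit z"
    have "closed A"
      unfolding A_def by (intro continuous_closed_vimage compact_imp_closed compact_orbit)
        (use c\<psi>[of UNIV] in \<open>simp add: continuous_on_eq_continuous_at\<close>)
    moreover have "P x \<in> A \<longleftrightarrow> x \<in> A" if "x \<in> {-d..d}" for x
      using P(1)[OF that] by (simp add: A_def orbit_flow_iff)
    moreover have "q (\<pi> z) \<in> A"
      using \<psi>q[of "\<pi> z"] \<theta>[OF z(1)] by (simp add: A_def \<pi>_def)
    ultimately obtain m where m: "m \<in> A" "m \<in> {-d..d}" "P m \<in> {-d..d}" "P (P m) = m"
      using e(2)[of A "q (\<pi> z)"] z(2) by blast
    define s where "s = \<theta> (\<Phi> T (\<psi> m))"
    define t where "t = \<theta> (\<Phi> T (\<psi> (P m)))"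
    have "\<psi> m = \<Phi> (t + T) (\<Phi> (s + T) (\<psi> m))"
      using P(1)[OF m(2)] P(1)[OF m(3)] m(4) by (simp add: s_def t_def)
    then have "\<Phi> (t + T + (s + T)) (\<psi> m) = \<psi> m" by (simp add: flow_add)
    then have "\<Phi> (t + T + (s + T)) z = z"
      by (rule period_orbit) (use m(1) in \<open>simp add: A_def orbit_sym\<close>)
    \<comment> \<open>The choice of \<open>T / 4\<close> in \<open>crossing_map\<close> puts the
      total time \<open>t + T + (s + T)\<close> between \<open>3 / 2 * T\<close> and
      \<open>5 / 2 * T\<close>: positive and at most \<open>3 * T\<close>.\<close>
    moreover have "\<bar>s\<bar> \<le> T / 4" "\<bar>t\<bar> \<le> T / 4"
      using P(2)[OF m(2)] P(2)[OF m(3)] \<eta>(2) by (simp_all add: s_def t_def)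
    ultimately show "\<exists>\<tau>. 0 < \<tau> \<and> \<tau> \<le> 3 * T \<and> \<Phi> \<tau> z = z"
      using T(1) by (intro exI[of _ "t + T + (s + T)"]) auto
  qed
qed

text \<open>The period is the same along an orbit. A point near \<open>w = \<Phi> s a\<close> is
  carried by the time \<open>T - s\<close> to a point near \<open>a\<close>, with distances
  multiplied by at most \<open>K\<close>; this is why the radius is divided by
  \<open>K\<close>.\<close>

lemma period_bounded_near_orbit:
  assumes "F a \<noteq> 0"
  obtains \<rho> T where "\<rho> > 0" "\<And>z. infdist z (orbit a) < \<rho> \<Longrightarrow> \<exists>\<tau>. 0 < \<tau> \<and> \<tau> \<le> T \<and> \<Phi> \<tau> z = z"
proof -
  obtain T where T: "T > 0" "\<Phi> T a = a"
    using flow_periodic[of a] flow_period_iff by blast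
  obtain \<rho>1 where \<rho>1: "\<rho>1 > 0" "\<And>z. z \<in> ball a \<rho>1 \<Longrightarrow> \<exists>\<tau>. 0 < \<tau> \<and> \<tau> \<le> 3 * T \<and> \<Phi> \<tau> z = z"
    using period_bounded_near_point[OF assms T] by metis
  have ne: "orbit a \<noteq> {}" using self_in_orbit by blast
  obtain \<rho>2 K where K: "\<rho>2 > 0" "K \<ge> 1" "\<And>z w t. \<lbrakk>infdist z (orbit a) < \<rho>2; infdist w (orbit a) < \<rho>2; \<bar>t\<bar> \<le> T\<rbrakk>
      \<Longrightarrow> dist (\<Phi> t z) (\<Phi> t w) \<le> K * dist z w"
    using flow_lipschitz_near[OF compact_orbit ne, of T] orbit_flow_iff by metis
  show thesis
  proof (rule that[of "min \<rho>2 (\<rho>1 / K)" "3 * T"])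
    show "min \<rho>2 (\<rho>1 / K) > 0" using \<rho>1 K by simp
    fix z assume z: "infdist z (orbit a) < min \<rho>2 (\<rho>1 / K)"
    obtain w where w: "w \<in> orbit a" "dist z w < min \<rho>2 (\<rho>1 / K)"
      by (rule infdist_lessE[OF z ne])
    obtain t where "w = \<Phi> t a" using w(1) by (auto simp: orbit_def)
    then obtain s where s: "0 \<le> s" "s < T" "w = \<Phi> s a"
      using flow_reduce_time[OF T(2,1), of t] by metis
    have "\<Phi> (T - s) w = a" using T(2) s(3) by (simp add: flow_add)
    moreover have "dist (\<Phi> (T - s) z) (\<Phi> (T - s) w) \<le> K * dist z w"
      using z w(1) K(1) s by (intro K(3)) auto
    moreover have "K * dist z w < \<rho>1" using w(2) K(2) by (simp add: field_simps)
    ultimately have "\<Phi> (T - s) z \<in> ball a \<rho>1" by (simp add: dist_commute)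
    then obtain \<tau> where \<tau>: "0 < \<tau>" "\<tau> \<le> 3 * T" "\<Phi> \<tau> (\<Phi> (T - s) z) = \<Phi> (T - s) z"
      using \<rho>1(2) by blast
    have "\<Phi> \<tau> z = z" by (rule period_orbit[OF \<tau>(3)]) (simp add: orbit_sym)
    then show "\<exists>\<tau>. 0 < \<tau> \<and> \<tau> \<le> 3 * T \<and> \<Phi> \<tau> z = z" using \<tau> by blast
  qed
qed

text \<open>The witness \<open>V z\<close> is the largest distance of the orbit of \<open>z\<close> from the orbit of \<open>a\<close>. Its
  Lipschitz continuity rests on the local bound for the periods.\<close>

lemma lipschitz_first_integral:
  assumes "F a \<noteq> 0"
  obtains V \<rho> K where "\<rho> > 0" "K \<ge> 1" "V a = 0" "\<And>t z. V (\<Phi> t z) = V z" "\<And>z. infdist z (orbit a) \<le> V z"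
    "\<And>z w. \<lbrakk>infdist z (orbit a) < \<rho>; infdist w (orbit a) < \<rho>\<rbrakk> \<Longrightarrow> V z \<le> V w + K * dist z w"
proof -
  let ?\<Gamma> = "orbit a"
  obtain \<rho>1 T where T: "\<rho>1 > 0" "\<And>z. infdist z ?\<Gamma> < \<rho>1 \<Longrightarrow> \<exists>\<tau>. 0 < \<tau> \<and> \<tau> \<le> T \<and> \<Phi> \<tau> z = z"
    using period_bounded_near_orbit[OF assms] by metis
  have ne: "?\<Gamma> \<noteq> {}" using self_in_orbit by blast
  obtain \<rho>2 K where K: "\<rho>2 > 0" "K \<ge> 1" "\<And>z w t. \<lbrakk>infdist z ?\<Gamma> < \<rho>2; infdist w ?\<Gamma> < \<rho>2; \<bar>t\<bar> \<le> T\<rbrakk>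
      \<Longrightarrow> dist (\<Phi> t z) (\<Phi> t w) \<le> K * dist z w"
    using flow_lipschitz_near[OF compact_orbit ne, of T] orbit_flow_iff by metis
  define V where "V z = (SUP w\<in>orbit z. infdist w ?\<Gamma>)" for z
  have bdd: "bdd_above ((\<lambda>w. infdist w ?\<Gamma>) ` orbit z)" for z
    by (intro bounded_imp_bdd_above compact_imp_bounded compact_continuous_image continuous_intros compact_orbit)
  have V_ge: "infdist w ?\<Gamma> \<le> V z" if "w \<in> orbit z" for w z
    unfolding V_def by (rule cSUP_upper[OF that bdd])
  have orbit_eq: "orbit (\<Phi> t z) = orbit z" for t z
    using orbit_flow_iff orbit_sym by blast
  show thesis
  proof (rule that[of "min \<rho>1 \<rho>2" K V])
    show "min \<rho>1 \<rho>2 > 0" "K \<ge> 1" using T K by auto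
    have "V a = (SUP w\<in>?\<Gamma>. 0)" unfolding V_def by (intro SUP_cong) auto
    then show "V a = 0" using ne by simp
    show "V (\<Phi> t z) = V z" for t z by (simp add: V_def orbit_eq)
    show "infdist z ?\<Gamma> \<le> V z" for z by (rule V_ge) simp
    fix z w assume zw: "infdist z ?\<Gamma> < min \<rho>1 \<rho>2" "infdist w ?\<Gamma> < min \<rho>1 \<rho>2"
    obtain \<tau> where \<tau>: "0 < \<tau>" "\<tau> \<le> T" "\<Phi> \<tau> z = z" using T(2)[of z] zw(1) by auto
    show "V z \<le> V w + K * dist z w"
      unfolding V_def[of z]
    proof (rule cSUP_least)
      show "orbit z \<noteq> {}" using self_in_orbit by blast
      fix u assume "u \<in> orbit z"
      then obtain t where "u = \<Phi> t z" by (auto simp: orbit_def)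
      \<comment> \<open>The whole orbit of \<open>z\<close> is traversed within its period
        \<open>\<tau> \<le> T\<close>, so the Lipschitz bound on the flow over bounded times reaches
        all of it.\<close>
      then obtain s where s: "0 \<le> s" "s < \<tau>" "u = \<Phi> s z"
        using flow_reduce_time[OF \<tau>(3,1), of t] by metis
      have "infdist u ?\<Gamma> \<le> infdist (\<Phi> s w) ?\<Gamma> + dist u (\<Phi> s w)" by (rule infdist_triangle)
      also have "dist u (\<Phi> s w) \<le> K * dist z w"
        unfolding s(3) using zw s \<tau> by (intro K(3)) auto
      also have "infdist (\<Phi> s w) ?\<Gamma> \<le> V w" by (rule V_ge) simp
      finally show "infdist u ?\<Gamma> \<le> V w + K * dist z w" by simp
    qed
  qed
qed

end

section \<open>Perturbed systems\<close>

context planar_periodic_flow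
begin

text \<open>On time intervals of length at most 1, \<open>y\<close> is compared with the unperturbed
  solution \<open>z\<close> starting at the same point, along which \<open>V\<close> is constant.
  Unit steps keep the Gronwall factor at \<open>exp L\<close>. The function \<open>E\<close> bounds
  the remaining integral of the forcing, so the increments of \<open>V\<close> telescope over any
  number of steps.\<close>

lemma perturbed_solution_approaches_orbit:
  assumes Fa: "F a \<noteq> 0"
    and y: "\<And>t. t0 \<le> t \<Longrightarrow> (y has_vector_derivative F (y t) + h t) (at t within {t0..})"
    and h: "continuous_on {t0..} h"
    and bdd: "bounded (y ` {t0..})"
    and E: "\<And>s t. \<lbrakk>t0 \<le> s; s \<le> t\<rbrakk> \<Longrightarrow> integral {s..t} (\<lambda>r. norm (h r)) \<le> E s - E t"
      "\<And>t. 0 \<le> E t" "(E \<longlongrightarrow> 0) at_top"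
    and cluster: "\<And>e s. 0 < e \<Longrightarrow> \<exists>t\<ge>s. dist (y t) a < e"
  shows "((\<lambda>t. infdist (y t) (orbit a)) \<longlongrightarrow> 0) at_top"
proof (rule tendstoI)
  let ?\<Gamma> = "orbit a"
  fix e :: real assume "e > 0"
  obtain V \<rho> K where \<rho>: "\<rho> > 0" and K: "K \<ge> 1" and Va: "V a = 0" and V_flow: "\<And>t z. V (\<Phi> t z) = V z"
    and V_ge: "\<And>z. infdist z ?\<Gamma> \<le> V z"
    and V_lip: "\<And>z w. \<lbrakk>infdist z ?\<Gamma> < \<rho>; infdist w ?\<Gamma> < \<rho>\<rbrakk> \<Longrightarrow> V z \<le> V w + K * dist z w"
    using lipschitz_first_integral[OF Fa] by metis
  \<comment> \<open>Contains \<open>y\<close> as well as the comparison solutions: as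
    \<open>V\<close> dominates the distance to the orbit of \<open>a\<close>, these stay within
    \<open>\<rho>\<close> of it.\<close>
  define X where "X = y ` {t0..} \<union> {z. infdist z ?\<Gamma> \<le> \<rho>}"
  have "?\<Gamma> \<noteq> {}" using self_in_orbit by blast
  then have "compact {z. infdist z ?\<Gamma> \<le> \<rho>}" using \<rho> by (intro compact_infdist_le compact_orbit) auto
  then have "bounded X" unfolding X_def using bdd compact_imp_bounded by simp
  then obtain L where L: "L-lipschitz_on X F" using bounded_lipschitzE[OF lip] by blast
  have L0: "0 \<le> L" using L lipschitz_on_nonneg by blast
  define C where "C = exp L"
  have C: "C > 0" by (simp add: C_def)
  \<comment> \<open>\<open>V (y u) < e'\<close> keeps \<open>z\<close> within
    \<open>\<rho> / 2\<close> of the orbit of \<open>a\<close>, and \<open>y\<close> departs from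
    \<open>z\<close> by less than \<open>e' / 2\<close>. So \<open>y\<close> stays within
    \<open>\<rho>\<close>, where \<open>V_lip\<close> applies.\<close>
  define e' where "e' = min e (\<rho> / 2)"
  have e': "0 < e'" "e' \<le> e" "e' \<le> \<rho> / 2" using \<open>e > 0\<close> \<rho> by (auto simp: e'_def)
  have KC: "0 < K * C" using K C by simp
  have "\<forall>\<^sub>F t in at_top. E t < e' / (2 * (K * C))"
    using e' KC by (intro order_tendstoD[OF E(3)]) auto
  then obtain s1 where s1: "\<And>t. t \<ge> s1 \<Longrightarrow> E t < e' / (2 * (K * C))"
    by (auto simp: eventually_at_top_linorder)
  have KCE: "K * C * E t < e' / 2" if "t \<ge> s1" for t
    using s1[OF that] KC by (simp add: field_simps)
  have step: "V (y t) \<le> V (y u) + K * C * (E u - E t)"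
    if u: "u \<ge> t0" "u \<ge> s1" "V (y u) < e'" and t: "u \<le> t" "t \<le> u + 1" for u t
  proof -
    define z where "z r = \<Phi> (r - u) (y u)" for r
    have Vz: "V (z r) = V (y u)" for r by (simp add: z_def V_flow)
    have zX: "infdist (z r) ?\<Gamma> < \<rho>" for r
      using V_ge[of "z r"] u(3) e'(3) \<rho> unfolding Vz by simp
    have "norm (y t - z t) \<le> (norm (y u - z u) + integral {u..t} (\<lambda>r. norm (h r))) * exp (L * (t - u))"
    proof (rule perturbed_solution_dist_le[OF L])
      fix r assume r: "r \<in> {u..t}"
      have "(y has_vector_derivative F (y r) + h r) (at r within {t0..})" using r u(1) by (intro y) simp
      then show "(y has_vector_derivative F (y r) + h r) (at r within {u..t})"
        by (rule has_vector_derivative_within_subset) (use u(1) in auto)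
      have "((\<lambda>r. \<Phi> (r + - u) (y u)) has_vector_derivative F (\<Phi> (r + - u) (y u))) (at r)"
        using autonomous_solution_shift[OF flow_solution[of "y u"], of "- u"]
        unfolding autonomous_solution_def by blast
      then show "(z has_vector_derivative F (z r)) (at r within {u..t})"
        unfolding z_def by (subst has_vector_derivative_at_within) simp_all
      show "y r \<in> X" using r u(1) by (simp add: X_def)
      show "z r \<in> X" using zX[of r] by (simp add: X_def)
    next
      show "continuous_on {u..t} h" by (rule continuous_on_subset[OF h]) (use u(1) in auto)
    qed (fact t)
    also have "y u - z u = 0" by (simp add: z_def)
    also have "(norm (0 :: real^2) + integral {u..t} (\<lambda>r. norm (h r))) * exp (L * (t - u)) \<le> (E u - E t) * C"
    proof (rule mult_mono)
      show "exp (L * (t - u)) \<le> C"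
        using L0 t mult_left_mono[of "t - u" 1 L] by (simp add: C_def)
      have "0 \<le> integral {u..t} (\<lambda>r. norm (h r))"
        using u(1) by (intro integral_nonneg integrable_continuous_real continuous_intros continuous_on_subset[OF h]) auto
      then show "0 \<le> E u - E t" using E(1)[OF u(1) t(1)] by linarith
      show "norm (0 :: real^2) + integral {u..t} (\<lambda>r. norm (h r)) \<le> E u - E t"
        using E(1)[OF u(1) t(1)] by simp
    qed simp
    finally have dist: "dist (y t) (z t) \<le> C * (E u - E t)" by (simp add: dist_norm mult.commute)
    also have "\<dots> \<le> C * E u" using E(2)[of t] C by (intro mult_left_mono) auto
    also have "\<dots> \<le> K * (C * E u)"
      using K C E(2)[of u] mult_right_mono[of 1 K "C * E u"] by simp
    also have "\<dots> < e' / 2" using KCE[OF u(2)] by (simp add: mult.assoc)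
    finally have "infdist (y t) ?\<Gamma> < \<rho>"
      using infdist_triangle[of "y t" ?\<Gamma> "z t"] V_ge[of "z t"] u(3) e' unfolding Vz by linarith
    then have "V (y t) \<le> V (z t) + K * dist (y t) (z t)" using zX by (rule V_lip)
    also have "K * dist (y t) (z t) \<le> K * (C * (E u - E t))"
      using dist K by (intro mult_left_mono) auto
    finally show ?thesis by (simp add: Vz mult.assoc)
  qed
  \<comment> \<open>One late visit near \<open>a\<close> suffices: it makes \<open>V\<close> smaller
    than \<open>e' / 2\<close>, and from then on \<open>V\<close> can gain less than
    \<open>e' / 2\<close> in total.\<close>
  obtain s where s: "s \<ge> max t0 s1" "dist (y s) a < min \<rho> (e' / (2 * K))"
    using cluster[of "min \<rho> (e' / (2 * K))" "max t0 s1"] \<rho> e' K by auto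
  have Vs: "V (y s) < e' / 2"
  proof -
    have "infdist (y s) ?\<Gamma> < \<rho>" using s(2) infdist_le[OF self_in_orbit[of a], of "y s"] by simp
    then have "V (y s) \<le> V a + K * dist (y s) a" by (rule V_lip) (simp add: \<rho>)
    also have "\<dots> < e' / 2" using s(2) K Va by (simp add: field_simps)
    finally show ?thesis .
  qed
  \<comment> \<open>Induction over unit steps. The accumulated bound itself gives
    \<open>V (y u) < e'\<close>, the condition under which \<open>step\<close> can be used
    again.\<close>
  have le: "V (y t) \<le> V (y s) + K * C * (E s - E t)" if "s \<le> t" "t \<le> s + real k" for k t
    using that
  proof (induction k arbitrary: t)
    case (Suc k)
    show ?case
    proof (cases "t \<le> s + real k")
      case False
      define u where "u = s + real k"
      have u: "V (y u) \<le> V (y s) + K * C * (E s - E u)" by (rule Suc.IH) (simp_all add: u_def)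
      have "K * C * (E s - E u) \<le> K * C * E s" using E(2)[of u] KC by (intro mult_left_mono) auto
      then have "V (y u) < e'" using u Vs KCE[of s] s(1) by simp
      then have "V (y t) \<le> V (y u) + K * C * (E u - E t)"
        using False Suc.prems s(1) by (intro step) (auto simp: u_def)
      then show ?thesis using u by (simp add: algebra_simps)
    qed (use Suc in auto)
  qed simp
  have "infdist (y t) ?\<Gamma> < e" if "t \<ge> s" for t
  proof -
    obtain k :: nat where "t - s \<le> real k" using real_arch_simple by blast
    then have "V (y t) \<le> V (y s) + K * C * (E s - E t)" using that by (intro le[of t k]) auto
    also have "K * C * (E s - E t) \<le> K * C * E s" using E(2)[of t] KC by (intro mult_left_mono) auto
    finally have "V (y t) < e'" using Vs KCE[of s] s(1) by simp
    then show ?thesis using V_ge[of "y t"] e' by simp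
  qed
  then show "\<forall>\<^sub>F t in at_top. dist (infdist (y t) ?\<Gamma>) 0 < e"
    by (auto simp: eventually_at_top_linorder infdist_nonneg intro!: exI[of _ s])
qed

end

section \<open>The dichotomy between the equilibrium and a closed orbit\<close>

lemma tendsto_0_or_cluster_point:
  fixes y :: "real \<Rightarrow> 'a::euclidean_space"
  assumes "bounded (y ` {t0..})"
  shows "(y \<longlongrightarrow> 0) at_top \<or> (\<exists>a. a \<noteq> 0 \<and> (\<forall>e>0. \<forall>s. \<exists>t\<ge>s. dist (y t) a < e))"
proof (rule disj_imp[THEN iffD2, rule_format])
  assume "\<not> (y \<longlongrightarrow> 0) at_top"
  then obtain e where e: "e > 0" "\<not> (\<forall>\<^sub>F t in at_top. dist (y t) 0 < e)"
    by (auto simp: tendsto_iff)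
  \<comment> \<open>The maximum keeps the times in the half-line where \<open>y\<close> is bounded
    and lets them tend to infinity. A cluster point of these values has norm at least
    \<open>e\<close>.\<close>
  have "\<exists>t\<ge>max t0 (real n). norm (y t) \<ge> e" for n
  proof (rule ccontr)
    assume "\<not> (\<exists>t\<ge>max t0 (real n). norm (y t) \<ge> e)"
    then have "\<forall>t\<ge>max t0 (real n). dist (y t) 0 < e"
      unfolding dist_0_norm dist_commute[of _ 0] not_le[symmetric] by blast
    then show False using e(2) unfolding eventually_at_top_linorder by metis
  qed
  then obtain t where t: "\<And>n. t n \<ge> max t0 (real n)" "\<And>n. norm (y (t n)) \<ge> e" by metis
  have "bounded (range (\<lambda>n. y (t n)))"
    by (rule bounded_subset[OF assms]) (use t(1) in auto)
  then obtain a r where r: "strict_mono r" "((\<lambda>n. y (t n)) \<circ> r) \<longlonglongrightarrow> a"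
    using bounded_imp_convergent_subsequence by blast
  have "(\<lambda>n. norm (((\<lambda>n. y (t n)) \<circ> r) n)) \<longlonglongrightarrow> norm a" by (intro tendsto_norm r(2))
  then have "e \<le> norm a" by (rule LIMSEQ_le_const) (use t(2) in auto)
  moreover have "\<exists>u\<ge>s. dist (y u) a < d" if d: "d > 0" for d s
  proof -
    obtain N where N: "\<And>n. n \<ge> N \<Longrightarrow> dist (y (t (r n))) a < d"
      using r(2) d unfolding lim_sequentially o_def by blast
    obtain k :: nat where k: "s \<le> real k" using real_arch_simple by blast
    define n where "n = max N k"
    have "real n \<le> t (r n)"
      using t(1)[of "r n"] seq_suble[OF r(1), of n] by simp
    then have "s \<le> t (r n)" using k by (simp add: n_def)
    then show ?thesis using N[of n] by (auto simp: n_def)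
  qed
  ultimately show "\<exists>a. a \<noteq> 0 \<and> (\<forall>e>0. \<forall>s. \<exists>t\<ge>s. dist (y t) a < e)"
    using e(1) by (intro exI[of _ a]) auto
qed

text \<open>If \<open>y\<close> tends to 0, the limiting trajectory is the degenerate one. Otherwise
  \<open>y\<close> has a cluster point \<open>a \<noteq> 0\<close>, where \<open>F\<close> does not
  vanish, and the orbit of \<open>a\<close> attracts \<open>y\<close>. Compactness is exported so
  that nearest points exist when the factors are multiplied.\<close>

lemma perturbed_global_center_approaches_trajectory:
  fixes F :: "real ^ 2 \<Rightarrow> real ^ 2"
  assumes F: "bounded_lipschitz F" and center: "global_center F"
    and y: "\<And>t. t0 \<le> t \<Longrightarrow> (y has_vector_derivative F (y t) + h t) (at t within {t0..})"
    and h: "continuous_on {t0..} h"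
    and bdd: "bounded (y ` {t0..})"
    and E: "\<And>s t. \<lbrakk>t0 \<le> s; s \<le> t\<rbrakk> \<Longrightarrow> integral {s..t} (\<lambda>r. norm (h r)) \<le> E s - E t"
      "\<And>t. 0 \<le> E t" "(E \<longlongrightarrow> 0) at_top"
  obtains C where "trajectory F C" "closed_trajectory F C \<and> 0 \<in> inside C \<or> C = {0}" "compact C"
    "((\<lambda>t. infdist (y t) C) \<longlongrightarrow> 0) at_top"
proof -
  have F0: "F z = 0 \<longleftrightarrow> z = 0" for z using center by (simp add: global_center_def)
  have trichotomy: "closed_trajectory F C \<and> 0 \<in> inside C \<or> C = {0}" if "trajectory F C" for C
    using center that by (auto simp: global_center_def)
  consider (zero) "(y \<longlongrightarrow> 0) at_top"
    | (cluster) a where "a \<noteq> 0" "\<forall>e>0. \<forall>s. \<exists>t\<ge>s. dist (y t) a < e"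
    using tendsto_0_or_cluster_point[OF bdd] by blast
  then show thesis
  proof cases
    case zero
    have "autonomous_solution F (\<lambda>_. 0) UNIV"
      using F0[of 0] by (auto simp: autonomous_solution_def)
    then have "trajectory F (range (\<lambda>_::real. 0))"
      unfolding trajectory_def using autonomous_solution_UNIV_maximal by blast
    then have "trajectory F {0}" by simp
    moreover have "((\<lambda>t. infdist (y t) {0}) \<longlongrightarrow> 0) at_top"
      using tendsto_norm[OF zero] by simp
    ultimately show ?thesis using that[of "{0}"] by simp
  next
    case cluster
    have "\<exists>z. autonomous_solution F z UNIV \<and> (\<exists>T>0. \<forall>t. z (t + T) = z t) \<and> z 0 = b" for b
      using global_center_periodic_solution[OF F center, of b] by metis
    \<comment> \<open>One periodic solution is chosen through each point separately; uniqueness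
      makes the choices fit together into a flow.\<close>
    then obtain \<Psi> where \<Psi>: "\<And>b. autonomous_solution F (\<Psi> b) UNIV" "\<And>b. \<exists>T>0. \<forall>t. \<Psi> b (t + T) = \<Psi> b t"
      "\<And>b. \<Psi> b 0 = b" by metis
    interpret planar_periodic_flow F "\<lambda>t z. \<Psi> z t"
      by unfold_locales (use F \<Psi> in \<open>simp_all add: autonomous_solution_def\<close>)
    have "trajectory F (orbit a)"
      unfolding trajectory_def orbit_def using autonomous_solution_UNIV_maximal[OF flow_solution] by blast
    moreover have "((\<lambda>t. infdist (y t) (orbit a)) \<longlongrightarrow> 0) at_top"
      by (rule perturbed_solution_approaches_orbit[OF _ y h bdd E]) (use cluster F0 in auto)
    ultimately show ?thesis using that[of "orbit a"] trichotomy compact_orbit by blast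
  qed
qed

section \<open>Integrable decay of the forcing and assembly of the torus\<close>

lemma integral_powr_tail_bound:
  fixes u :: "real \<Rightarrow> real"
  assumes p: "p > 1" and s: "0 < s" "s \<le> t" and u: "continuous_on {s..t} u"
    and le: "\<And>r. r \<in> {s..t} \<Longrightarrow> u r \<le> r powr (- p)"
  shows "integral {s..t} u \<le> s powr (1 - p) / (p - 1) - t powr (1 - p) / (p - 1)"
proof -
  \<comment> \<open>The antiderivative is written with \<open>p - 1\<close> in the denominator, so
    that the bound is a difference of values of a nonnegative function tending to 0 for
    \<open>p > 1\<close>, as required of \<open>E\<close>.\<close>
  have "((\<lambda>r. r powr (- p)) has_integral - (t powr (1 - p) / (p - 1)) - (- (s powr (1 - p) / (p - 1)))) {s..t}"
  proof (rule fundamental_theorem_of_calculus)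
    fix r assume "r \<in> {s..t}"
    then have "r > 0" using s by simp
    then have "((\<lambda>r. r powr (1 - p)) has_real_derivative (1 - p) * r powr (1 - p - 1)) (at r within {s..t})"
      by (rule has_field_derivative_at_within[OF has_real_derivative_powr])
    from DERIV_cmult[OF this, of "- 1 / (p - 1)"]
    moreover have "- 1 / (p - 1) * ((1 - p) * r powr (1 - p - 1)) = r powr (- p)"
      using p by (simp add: divide_simps) (simp add: algebra_simps)
    ultimately have "((\<lambda>r. - (r powr (1 - p) / (p - 1))) has_real_derivative r powr (- p)) (at r within {s..t})"
      by simp
    then show "((\<lambda>r. - (r powr (1 - p) / (p - 1))) has_vector_derivative r powr (- p)) (at r within {s..t})"
      by (simp add: has_real_derivative_iff_has_vector_derivative)
  qed (fact s)
  then have "integral {s..t} u \<le> - (t powr (1 - p) / (p - 1)) - (- (s powr (1 - p) / (p - 1)))"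
    using le by (intro has_integral_le[OF integrable_integral[OF integrable_continuous_real[OF u]]]) auto
  then show ?thesis by simp
qed

text \<open>Nearest points in the factors, which exist by closedness, assemble to a point of the
  product, and the Euclidean norm is at most the sum of the norms of the components.\<close>

lemma infdist_product_le:
  fixes C :: "'n::finite \<Rightarrow> 'a::euclidean_space set" and x :: "'a ^ 'n"
  assumes "\<And>k. closed (C k)" "\<And>k. C k \<noteq> {}"
  shows "infdist x {z. \<forall>k. z $ k \<in> C k} \<le> (\<Sum>k\<in>UNIV. infdist (x $ k) (C k))"
proof -
  have "\<exists>c\<in>C k. infdist (x $ k) (C k) = dist (x $ k) c" for k
  proof -
    obtain c where c: "c \<in> C k" "\<And>w. w \<in> C k \<Longrightarrow> dist (x $ k) c \<le> dist (x $ k) w"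
      using distance_attains_inf[OF assms] by metis
    then have "infdist (x $ k) (C k) = dist (x $ k) c"
      using assms(2)[of k] infdist_le[OF c(1)] by (intro antisym) (auto simp: infdist_notempty intro!: cINF_greatest)
    then show ?thesis using c(1) by blast
  qed
  then obtain c where c: "\<And>k. c k \<in> C k" "\<And>k. infdist (x $ k) (C k) = dist (x $ k) (c k)" by metis
  have "infdist x {z. \<forall>k. z $ k \<in> C k} \<le> dist x (\<chi> k. c k)"
    by (rule infdist_le) (simp add: c)
  also have "\<dots> \<le> (\<Sum>k\<in>UNIV. dist (x $ k) (c k))"
    unfolding dist_norm norm_vec_def by (rule order_trans[OF L2_set_le_sum]) auto
  finally show ?thesis by (simp add: c)
qed

theorem theorem4p4:
  fixes f :: "'n::finite \<Rightarrow> real ^ 2 \<Rightarrow> real ^ 2"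
    and g :: "real \<Rightarrow> (real ^ 2) ^ 'n \<Rightarrow> (real ^ 2) ^ 'n"
    and x :: "real \<Rightarrow> (real ^ 2) ^ 'n"
    and t0 p :: real
  assumes "\<And>k. C1_map (f k)"
    and "\<And>k. global_center (f k)"
    and "C01_map g"
    and "\<And>t. t \<ge> t0 \<Longrightarrow>
           (x has_vector_derivative (product_field f (x t) + g t (x t))) (at t within {t0..})"
    and "bounded (x ` {t0..})"
    and "p > 1"
    and "((\<lambda>t. t powr p * norm (g t (x t))) \<longlongrightarrow> 0) at_top"
  shows "\<exists>S. invariant_torus f S \<and> ((\<lambda>t. infdist (x t) S) \<longlongrightarrow> 0) at_top"
proof -
  have "\<forall>\<^sub>F t in at_top. t powr p * norm (g t (x t)) < 1"
    using assms(7) by (rule order_tendstoD) simp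
  then obtain t1 where t1: "\<And>t. t \<ge> t1 \<Longrightarrow> t powr p * norm (g t (x t)) < 1"
    by (auto simp: eventually_at_top_linorder)
  \<comment> \<open>From \<open>b\<close> on, the solution is defined, the forcing is at most
    \<open>t powr (- p)\<close>, and time is positive, as the power integral requires.\<close>
  define b where "b = max t0 (max t1 1)"
  have b: "b \<ge> t0" "b \<ge> t1" "b \<ge> 1" by (auto simp: b_def)
  have small: "norm (g t (x t)) \<le> t powr (- p)" if "t \<ge> b" for t
    using t1[of t] that b by (simp add: powr_minus field_simps)
  have "continuous_on {t0..} x"
    by (rule continuous_on_vector_derivative, rule assms(4)) simp
  then have cx: "continuous_on {b..} x" by (rule continuous_on_subset) (use b in auto)
  have "continuous_on UNIV (\<lambda>(t, z). g t z)" using assms(3) by (simp add: C01_map_def)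
  then have cg: "continuous_on {b..} (\<lambda>t. g t (x t))"
    using continuous_on_compose2[OF _ continuous_on_Pair[OF continuous_on_id cx], of UNIV "\<lambda>(t, z). g t z"] by simp
  define E where "E t = t powr (1 - p) / (p - 1)" for t
  \<comment> \<open>Along the given solution \<open>g t (x t)\<close> depends on \<open>t\<close>
    alone, so each component satisfies a forced planar equation with the common tail bound
    \<open>E\<close>.\<close>
  have "\<exists>C. trajectory (f k) C \<and> (closed_trajectory (f k) C \<and> 0 \<in> inside C \<or> C = {0}) \<and> compact C \<and>
      ((\<lambda>t. infdist (x t $ k) C) \<longlongrightarrow> 0) at_top" for k
  proof -
    have 1: "((\<lambda>t. x t $ k) has_vector_derivative f k (x t $ k) + g t (x t) $ k) (at t within {b..})" if "b \<le> t" for t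
    proof -
      have "(x has_vector_derivative (product_field f (x t) + g t (x t))) (at t within {b..})"
        by (rule has_vector_derivative_within_subset[OF assms(4)]) (use that b in auto)
      from bounded_linear.has_vector_derivative[OF bounded_linear_vec_nth this, of k]
      show ?thesis by (simp add: product_field_def)
    qed
    have 2: "continuous_on {b..} (\<lambda>t. g t (x t) $ k)" by (intro continuous_intros cg)
    have "bounded ((\<lambda>z. z $ k) ` x ` {t0..})"
      by (rule bounded_linear_image[OF assms(5) bounded_linear_vec_nth])
    then have 3: "bounded ((\<lambda>t. x t $ k) ` {b..})"
      by (rule bounded_subset) (use b in auto)
    have 4: "integral {s..t} (\<lambda>r. norm (g r (x r) $ k)) \<le> E s - E t" if "b \<le> s" "s \<le> t" for s t
      unfolding E_def
    proof (rule integral_powr_tail_bound[OF assms(6)])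
      show "continuous_on {s..t} (\<lambda>r. norm (g r (x r) $ k))"
        by (intro continuous_on_norm continuous_on_subset[OF 2]) (use that in auto)
      fix r assume "r \<in> {s..t}"
      then show "norm (g r (x r) $ k) \<le> r powr (- p)"
        using small[of r] Finite_Cartesian_Product.norm_nth_le[of "g r (x r)" k] that by simp
    qed (use that b in auto)
    have 5: "0 \<le> E t" for t using assms(6) by (simp add: E_def)
    have "((\<lambda>t. t powr (1 - p) / (p - 1)) \<longlongrightarrow> 0 / (p - 1)) at_top"
      using assms(6) by (intro tendsto_divide tendsto_neg_powr filterlim_ident tendsto_const) auto
    then have 6: "(E \<longlongrightarrow> 0) at_top" by (simp add: E_def[abs_def])
    show ?thesis
      using perturbed_global_center_approaches_trajectory[OF C1_map_bounded_lipschitz[OF assms(1)] assms(2) 1 2 3 4 5 6]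
      by metis
  qed
  then obtain C where C: "\<And>k. trajectory (f k) (C k)" "\<And>k. closed_trajectory (f k) (C k) \<and> 0 \<in> inside (C k) \<or> C k = {0}"
    "\<And>k. compact (C k)" "\<And>k. ((\<lambda>t. infdist (x t $ k) (C k)) \<longlongrightarrow> 0) at_top" by metis
  define S where "S = {z. \<forall>k. z $ k \<in> C k}"
  have ne: "C k \<noteq> {}" for k
    using C(1)[of k] by (auto simp: trajectory_def maximal_solution_def autonomous_solution_def)
  have "invariant_torus f S"
    unfolding invariant_torus_def S_def using C(1,2) by blast
  moreover have "((\<lambda>t. infdist (x t) S) \<longlongrightarrow> 0) at_top"
  proof (rule tendsto_sandwich[OF _ _ tendsto_const])
    show "\<forall>\<^sub>F t in at_top. 0 \<le> infdist (x t) S" by (simp add: infdist_nonneg)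
    show "\<forall>\<^sub>F t in at_top. infdist (x t) S \<le> (\<Sum>k\<in>UNIV. infdist (x t $ k) (C k))"
      unfolding S_def by (intro always_eventually allI infdist_product_le compact_imp_closed C(3) ne)
    have "((\<lambda>t. \<Sum>k\<in>UNIV. infdist (x t $ k) (C k)) \<longlongrightarrow> (\<Sum>k\<in>(UNIV :: 'n set). 0)) at_top"
      by (intro tendsto_sum C(4))
    then show "((\<lambda>t. \<Sum>k\<in>UNIV. infdist (x t $ k) (C k)) \<longlongrightarrow> 0) at_top" by simp
  qed
  ultimately show ?thesis by blast
qed

end
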